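(* Let $N\ge 2$ and write $x=(x',x_N)\in\mathbb{R}^{N-1}\times\mathbb{R}$. Let $f:\mathbb{R}\to\mathbb{R}$ be a $C^1$ function such that $f(0)=0$ and, for some $\varepsilon>0$, $f'(s)\le 0$ for all $s\in(0,\varepsilon)$. Assume that the one-dimensional problem $$-v''=f(v)\ \text{ on }\mathbb{R},\qquad v\ge 0,\qquad v(t)\to 0\ \text{ as }|t|\to\infty$$ admits no positive solution. Let $u>0$ be a bounded solution to $$\begin{cases}-\Delta u=f(u) & \text{in }\mathbb{R}^N,\\ u(x',x_N)\to 0 & \text{as }|x_N|\to\infty,\text{ uniformly in }x',\\ \nabla_{x'}u(x',x_N)\to 0 & \text{as }|x'|\to\infty,\text{ for any }x_N.\end{cases}$$ Then $u$ is radially symmetric, that is, there exists $y\in\mathbb{R}^N$ such that $u(x)$ depends only on $|x-y|$.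
   Context: Solutions are classical ($C^2$). $\nabla_{x'}$ denotes the gradient with respect to the first $N-1$ variables. *)

theory Defs
  imports "HOL-Analysis.Analysis"
begin

definition partial_deriv :: "'a::euclidean_space \<Rightarrow> ('a \<Rightarrow> real) \<Rightarrow> 'a \<Rightarrow> real" where
  "partial_deriv b g x = deriv (\<lambda>t. g (x + t *\<^sub>R b)) 0"

definition grad :: "('a::euclidean_space \<Rightarrow> real) \<Rightarrow> 'a \<Rightarrow> 'a" where
  "grad g x = (\<Sum>b\<in>Basis. partial_deriv b g x *\<^sub>R b)"

definition laplacian :: "('a::euclidean_space \<Rightarrow> real) \<Rightarrow> 'a \<Rightarrow> real" where
  "laplacian g x = (\<Sum>b\<in>Basis. partial_deriv b (partial_deriv b g) x)"

(* The differentiability clause guards against the junk value of deriv at points where the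
   partial derivative does not exist; with
   continuity of the partial derivatives this is the usual class of C^1 functions. *)
definition C1 :: "('a::euclidean_space \<Rightarrow> real) \<Rightarrow> bool" where
  "C1 g \<longleftrightarrow> (\<forall>x. g differentiable (at x)) \<and>
            (\<forall>b\<in>Basis. continuous_on UNIV (partial_deriv b g))"

definition C2 :: "('a::euclidean_space \<Rightarrow> real) \<Rightarrow> bool" where
  "C2 g \<longleftrightarrow> C1 g \<and> (\<forall>b\<in>Basis. C1 (partial_deriv b g))"

definition grad_fst :: "('a::euclidean_space \<times> real \<Rightarrow> real) \<Rightarrow> 'a \<times> real \<Rightarrow> 'a" where
  "grad_fst u = (\<lambda>(x', t). grad (\<lambda>y. u (y, t)) x')"

(* On the reals, at_infinity is the filter |t| to infinity. *)
definition solves_1d :: "(real \<Rightarrow> real) \<Rightarrow> (real \<Rightarrow> real) \<Rightarrow> bool" where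
  "solves_1d f v \<longleftrightarrow>
     v C1_differentiable_on UNIV \<and> deriv v C1_differentiable_on UNIV \<and>
     (\<forall>t. - deriv (deriv v) t = f (v t)) \<and>
     (\<forall>t. v t \<ge> 0) \<and>
     (v \<longlongrightarrow> 0) at_infinity"

lemma partial_deriv_eq_frechet_derivative:
  assumes "g differentiable (at x)"
  shows "partial_deriv b g x = frechet_derivative g (at x) b"
proof -
  have "(g has_derivative frechet_derivative g (at x)) (at (x + 0 *\<^sub>R b))"
    using assms frechet_derivative_works by auto
  then have "((\<lambda>t. g (x + t *\<^sub>R b)) has_derivative
      (\<lambda>t. frechet_derivative g (at x) (t *\<^sub>R b))) (at 0)"
    by (rule has_derivative_compose[rotated]) (auto intro!: derivative_eq_intros)
  moreover have "frechet_derivative g (at x) (t *\<^sub>R b) = frechet_derivative g (at x) b * t" for t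
    using linear_frechet_derivative[OF assms] by (simp add: linear_cmul)
  ultimately have "((\<lambda>t. g (x + t *\<^sub>R b)) has_real_derivative frechet_derivative g (at x) b) (at 0)"
    by (simp add: has_field_derivative_def)
  then show ?thesis
    by (simp add: partial_deriv_def DERIV_imp_deriv)
qed

lemma GDERIV_grad:
  assumes "g differentiable (at x)"
  shows "GDERIV g x :> grad g x"
proof -
  have "frechet_derivative g (at x) h = h \<bullet> grad g x" for h
  proof -
    have lin: "linear (frechet_derivative g (at x))"
      by (rule linear_frechet_derivative[OF assms])
    have "frechet_derivative g (at x) h
        = frechet_derivative g (at x) (\<Sum>b\<in>Basis. (h \<bullet> b) *\<^sub>R b)"
      by (simp add: euclidean_representation)
    also have "\<dots> = (\<Sum>b\<in>Basis. (h \<bullet> b) * frechet_derivative g (at x) b)"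
      by (simp add: linear_sum[OF lin] linear_cmul[OF lin])
    also have "\<dots> = h \<bullet> grad g x"
      by (simp add: grad_def inner_sum_right partial_deriv_eq_frechet_derivative[OF assms]
          mult.commute)
    finally show ?thesis .
  qed
  then have "frechet_derivative g (at x) = (\<lambda>h. h \<bullet> grad g x)"
    by auto
  then show ?thesis
    using assms frechet_derivative_works unfolding gderiv_def by metis
qed

lemma laplacian_real: "laplacian v t = deriv (deriv v) t" for v :: "real \<Rightarrow> real"
proof -
  have "deriv (\<lambda>s. w (x + s)) 0 = deriv w x" for w :: "real \<Rightarrow> real" and x
    using DERIV_shift[of w _ 0 x] by (simp add: deriv_def add.commute)
  then show ?thesis
    by (simp add: laplacian_def partial_deriv_def)
qed

end

theory Submission
  imports Defs "HOL-Complex_Analysis.Great_Picard"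
begin

text \<open>
  First, \<open>u\<close> tends to \<open>0\<close> at infinity in all directions. Otherwise there are points escaping to
  infinity, necessarily in the first variables, where \<open>u\<close> stays away from \<open>0\<close>. As \<open>u\<close> is Lipschitz,
  translates of \<open>u\<close> converge along a subsequence, and since the partial gradient tends to \<open>0\<close> the
  limit \<open>v\<close> depends on the last variable only. Comparing \<open>v\<close> with a second antiderivative of
  \<open>- f \<circ> v\<close> shows that \<open>v\<close> solves the one-dimensional problem, and the strong maximum principle
  makes it positive, which is excluded by assumption.

  Secondly, the moving plane method applies in every direction \<open>e\<close>. Because \<open>f\<close> is nonincreasing on
  \<open>(0, \<epsilon>)\<close>, a negative minimum of the difference between the reflected solution and \<open>u\<close> is attained
  where \<open>u \<ge> \<epsilon>\<close>, hence in a fixed ball. At the critical position Hopf's lemma then forces symmetry.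

  Finally, the hyperplanes of symmetry all pass through one point: otherwise a reflection combined
  with the central symmetry would yield an unbounded orbit on which \<open>u\<close> is constant.
\<close>

section \<open>Second differences\<close>

text \<open>The Laplacian is taken as a limit of second differences. This requires no derivatives near the
  point, which suits comparison functions, and the second-derivative test becomes immediate.\<close>

definition second_diff :: "('a::euclidean_space \<Rightarrow> real) \<Rightarrow> 'a \<Rightarrow> real \<Rightarrow> real" where
  "second_diff w x t = (\<Sum>b\<in>Basis. (w (x + t *\<^sub>R b) + w (x - t *\<^sub>R b) - 2 * w x) / t\<^sup>2)"

definition has_laplacian :: "('a::euclidean_space \<Rightarrow> real) \<Rightarrow> 'a \<Rightarrow> real \<Rightarrow> bool" where
  "has_laplacian w x L \<longleftrightarrow> (second_diff w x \<longlongrightarrow> L) (at 0)"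

lemma has_laplacian_add:
  assumes "has_laplacian v x L" "has_laplacian w x K"
  shows "has_laplacian (\<lambda>y. v y + w y) x (L + K)"
proof -
  have "second_diff (\<lambda>y. v y + w y) x = (\<lambda>t. second_diff v x t + second_diff w x t)"
    by (auto simp: second_diff_def sum.distrib[symmetric] add_divide_distrib diff_divide_distrib
        algebra_simps intro!: sum.cong)
  then show ?thesis
    using assms unfolding has_laplacian_def by (auto intro: tendsto_add)
qed

lemma has_laplacian_cmult:
  assumes "has_laplacian w x L"
  shows "has_laplacian (\<lambda>y. c * w y) x (c * L)"
proof -
  have "second_diff (\<lambda>y. c * w y) x = (\<lambda>t. c * second_diff w x t)"
    by (auto simp: second_diff_def sum_distrib_left algebra_simps intro!: sum.cong)
  then show ?thesis
    using assms unfolding has_laplacian_def by (auto intro: tendsto_mult_left)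
qed

lemma has_laplacian_diff:
  assumes "has_laplacian v x L" "has_laplacian w x K"
  shows "has_laplacian (\<lambda>y. v y - w y) x (L - K)"
  using has_laplacian_add[OF assms(1) has_laplacian_cmult[OF assms(2), of "-1"]] by simp

lemma has_laplacian_const: "has_laplacian (\<lambda>y. c) x 0"
  by (simp add: has_laplacian_def second_diff_def[abs_def])

lemma has_laplacian_translate:
  assumes "has_laplacian w (x + c) L"
  shows "has_laplacian (\<lambda>y. w (y + c)) x L"
proof -
  have "second_diff (\<lambda>y. w (y + c)) x = second_diff w (x + c)"
    by (auto simp: second_diff_def algebra_simps fun_eq_iff)
  then show ?thesis
    using assms by (simp add: has_laplacian_def)
qed

text \<open>For a polynomial of degree at most four the odd powers of \<open>t\<close> cancel in the
  second difference, which leaves the Laplacian plus a multiple of \<open>t\<^sup>2\<close>;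
  \<open>K\<close> records that multiple and is nonzero only for the quartic below.\<close>

lemma has_laplacian_eqI:
  assumes "\<And>t. t \<noteq> 0 \<Longrightarrow> second_diff w x t = L + t\<^sup>2 * K"
  shows "has_laplacian w x L"
proof -
  have "((\<lambda>t. L + t\<^sup>2 * K) \<longlongrightarrow> L + 0\<^sup>2 * K) (at 0)"
    by (intro tendsto_intros)
  then have "((\<lambda>t. L + t\<^sup>2 * K) \<longlongrightarrow> L) (at 0)"
    by simp
  then show ?thesis
    unfolding has_laplacian_def
    by (rule Lim_transform_eventually) (use assms in \<open>auto simp: eventually_at_filter\<close>)
qed

section \<open>Laplacians of the polynomials that serve as barriers\<close>

lemma has_laplacian_inner_sq:
  "has_laplacian (\<lambda>y. (e \<bullet> y)\<^sup>2) x (2 * (norm e)\<^sup>2)"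
proof (rule has_laplacian_eqI[where K = 0])
  fix t :: real
  assume t: "t \<noteq> 0"
  have "second_diff (\<lambda>y. (e \<bullet> y)\<^sup>2) x t = (\<Sum>b\<in>Basis. 2 * ((e \<bullet> b) * (e \<bullet> b)))"
    unfolding second_diff_def
    using t by (intro sum.cong) (auto simp: inner_simps power2_eq_square field_simps)
  also have "\<dots> = 2 * (norm e)\<^sup>2"
    by (simp add: sum_distrib_left[symmetric] euclidean_inner[of e e, symmetric] power2_norm_eq_inner)
  finally show "second_diff (\<lambda>y. (e \<bullet> y)\<^sup>2) x t = 2 * (norm e)\<^sup>2 + t\<^sup>2 * 0" by simp
qed

lemma has_laplacian_inner: "has_laplacian (\<lambda>y. e \<bullet> y) x 0"
  by (rule has_laplacian_eqI[where K = 0]) (simp add: second_diff_def inner_simps)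

lemma norm_sq_add_scaled_unit:
  fixes x :: "'a::real_inner"
  shows "b \<bullet> b = 1 \<Longrightarrow> (norm (x + t *\<^sub>R b - z))\<^sup>2 = (norm (x - z))\<^sup>2 + 2 * t * ((x - z) \<bullet> b) + t\<^sup>2"
    and "b \<bullet> b = 1 \<Longrightarrow> (norm (x - t *\<^sub>R b - z))\<^sup>2 = (norm (x - z))\<^sup>2 - 2 * t * ((x - z) \<bullet> b) + t\<^sup>2"
  unfolding power2_norm_eq_inner power2_eq_square[of t] by (auto simp: inner_simps inner_commute algebra_simps)

lemma has_laplacian_norm_sq:
  fixes x :: "'a::euclidean_space"
  shows "has_laplacian (\<lambda>y. (norm (y - z))\<^sup>2) x (2 * DIM('a))"
proof (rule has_laplacian_eqI[where K = 0])
  fix t :: real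
  assume t: "t \<noteq> 0"
  have "second_diff (\<lambda>y. (norm (y - z))\<^sup>2) x t = (\<Sum>b\<in>(Basis :: 'a set). 2)"
    unfolding second_diff_def
    using t by (intro sum.cong) (auto simp: norm_sq_add_scaled_unit)
  then show "second_diff (\<lambda>y. (norm (y - z))\<^sup>2) x t = 2 * DIM('a) + t\<^sup>2 * 0" by simp
qed

lemma has_laplacian_norm_pow4:
  fixes x :: "'a::euclidean_space"
  shows "has_laplacian (\<lambda>y. ((norm (y - z))\<^sup>2)\<^sup>2) x ((4 * DIM('a) + 8) * (norm (x - z))\<^sup>2)"
proof (rule has_laplacian_eqI[where K = "2 * DIM('a)"])
  fix t :: real
  assume t: "t \<noteq> 0"
  let ?s = "(norm (x - z))\<^sup>2"
  have "second_diff (\<lambda>y. ((norm (y - z))\<^sup>2)\<^sup>2) x t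
      = (\<Sum>b\<in>(Basis :: 'a set). 4 * ?s + 2 * t\<^sup>2 + 8 * (((x - z) \<bullet> b) * ((x - z) \<bullet> b)))"
    unfolding second_diff_def
  proof (intro sum.cong refl)
    fix b :: 'a
    assume "b \<in> Basis"
    then have b: "b \<bullet> b = 1" by simp
    have "(?s + 2 * t * d + t\<^sup>2)\<^sup>2 + (?s - 2 * t * d + t\<^sup>2)\<^sup>2 - 2 * ?s\<^sup>2
        = (4 * ?s + 2 * t\<^sup>2 + 8 * (d * d)) * t\<^sup>2" for d
      by (simp add: power2_eq_square algebra_simps)
    then show "(((norm (x + t *\<^sub>R b - z))\<^sup>2)\<^sup>2 + ((norm (x - t *\<^sub>R b - z))\<^sup>2)\<^sup>2 - 2 * ?s\<^sup>2) / t\<^sup>2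
        = 4 * ?s + 2 * t\<^sup>2 + 8 * (((x - z) \<bullet> b) * ((x - z) \<bullet> b))"
      using t unfolding norm_sq_add_scaled_unit[OF b] by simp
  qed
  also have "\<dots> = DIM('a) * (4 * ?s + 2 * t\<^sup>2) + 8 * ?s"
    by (simp add: sum.distrib sum_distrib_left[symmetric] euclidean_inner[of "x - z" "x - z", symmetric]
        power2_norm_eq_inner)
  finally show "second_diff (\<lambda>y. ((norm (y - z))\<^sup>2)\<^sup>2) x t
      = (4 * DIM('a) + 8) * ?s + t\<^sup>2 * (2 * DIM('a))"
    by (simp add: algebra_simps)
qed

text \<open>Every summand of the second difference is nonnegative for small \<open>t\<close>, and
  this sign survives the limit. All comparison arguments below use the second-derivative test in
  this form.\<close>

lemma has_laplacian_local_min: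
  assumes lap: "has_laplacian w x L" and "\<forall>\<^sub>F y in nhds x. w x \<le> w y"
  shows "0 \<le> L"
proof -
  obtain d where d: "d > 0" "\<And>y. dist y x < d \<Longrightarrow> w x \<le> w y"
    using assms(2) unfolding eventually_nhds_metric by blast
  have "\<forall>\<^sub>F t in at 0. 0 \<le> second_diff w x t"
    unfolding eventually_at
  proof (intro exI[of _ d] conjI ballI impI)
    fix t :: real
    assume t: "t \<noteq> 0 \<and> dist t 0 < d"
    have "w x \<le> w (x + t *\<^sub>R b)" "w x \<le> w (x - t *\<^sub>R b)" if "b \<in> Basis" for b
      using that t by (auto intro!: d(2) simp: dist_norm)
    then show "0 \<le> second_diff w x t"
      unfolding second_diff_def by (intro sum_nonneg divide_nonneg_nonneg) fastforce+
  qed (use d in auto)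
  then show ?thesis
    using lap unfolding has_laplacian_def by (intro tendsto_lowerbound[of "second_diff w x" L "at 0"]) auto
qed

text \<open>L'Hopital's rule, applied once, leaves a symmetric difference quotient of
  \<open>\<phi>'\<close>. Its limit needs only the derivative of \<open>\<phi>'\<close> at
  \<open>x\<close> itself.\<close>

lemma second_diff_tendsto:
  fixes \<phi> :: "real \<Rightarrow> real"
  assumes d1: "\<And>t. (\<phi> has_real_derivative \<phi>' t) (at t)"
    and d2: "(\<phi>' has_real_derivative c) (at x)"
  shows "((\<lambda>t. (\<phi> (x + t) + \<phi> (x - t) - 2 * \<phi> x) / t\<^sup>2) \<longlongrightarrow> c) (at 0)"
proof -
  have s: "((\<lambda>t. \<phi>' (x + t)) has_real_derivative c) (at 0)"
    using d2 DERIV_shift[of \<phi>' c 0 x] by (simp add: add.commute)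
  have s': "((\<lambda>t. \<phi>' (x - t)) has_real_derivative - c) (at 0)"
    by (rule DERIV_cong[OF DERIV_chain2[where g = "\<lambda>t. x - t" and f = \<phi>']])
       (use d2 in \<open>auto intro!: derivative_eq_intros\<close>)
  have "((\<lambda>t. \<phi>' (x + t) - \<phi>' (x - t)) has_real_derivative 2 * c) (at 0)"
    using DERIV_diff[OF s s'] by simp
  then have "((\<lambda>t. (\<phi>' (x + t) - \<phi>' (x - t)) / t) \<longlongrightarrow> 2 * c) (at 0)"
    by (simp add: has_field_derivative_iff)
  then have lim: "((\<lambda>t. (\<phi>' (x + t) - \<phi>' (x - t)) / (2 * t)) \<longlongrightarrow> c) (at 0)"
    using tendsto_mult_left[of _ "2 * c" "at 0" "1/2"] by (fastforce simp: field_simps)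
  have cont: "isCont \<phi> t" for t
    using d1 DERIV_isCont by blast
  show ?thesis
  proof (rule lhopital[OF _ _ _ _ _ _ lim])
    have "((\<lambda>t. \<phi> (x + t) + \<phi> (x - t) - 2 * \<phi> x) \<longlongrightarrow> \<phi> (x + 0) + \<phi> (x - 0) - 2 * \<phi> x) (at 0)"
      by (intro tendsto_intros isCont_tendsto_compose[OF cont])
    then show "((\<lambda>t. \<phi> (x + t) + \<phi> (x - t) - 2 * \<phi> x) \<longlongrightarrow> 0) (at 0)" by simp
    show "((\<lambda>t::real. t\<^sup>2) \<longlongrightarrow> 0) (at 0)"
      by (rule tendsto_eq_intros | simp)+
    show "\<forall>\<^sub>F t::real in at 0. t\<^sup>2 \<noteq> 0" "\<forall>\<^sub>F t::real in at 0. 2 * t \<noteq> 0"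
      by (auto simp: eventually_at_filter)
    show "\<forall>\<^sub>F t in at 0. ((\<lambda>t. \<phi> (x + t) + \<phi> (x - t) - 2 * \<phi> x) has_real_derivative
        \<phi>' (x + t) - \<phi>' (x - t)) (at t)"
      by (auto intro!: always_eventually derivative_eq_intros DERIV_chain2[OF d1])
    show "\<forall>\<^sub>F t in at 0. ((\<lambda>t. t\<^sup>2) has_real_derivative 2 * t) (at t)"
      by (auto intro!: always_eventually derivative_eq_intros)
  qed
qed

lemma C1_line_derivative:
  assumes "C1 g"
  shows "((\<lambda>t. g (x + t *\<^sub>R e)) has_real_derivative (\<Sum>i\<in>Basis. (e \<bullet> i) * partial_deriv i g (x + t *\<^sub>R e))) (at t)"
proof -
  have "g differentiable at (x + t *\<^sub>R e)"
    using assms by (auto simp: C1_def)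
  then have "(g has_derivative (\<lambda>h. h \<bullet> grad g (x + t *\<^sub>R e))) (at (x + t *\<^sub>R e))"
    using GDERIV_grad unfolding gderiv_def by blast
  then have "((\<lambda>t. g (x + t *\<^sub>R e)) has_derivative (\<lambda>s. (s *\<^sub>R e) \<bullet> grad g (x + t *\<^sub>R e))) (at t)"
    by (rule has_derivative_compose[rotated]) (auto intro!: derivative_eq_intros)
  moreover have "(\<lambda>s. (s *\<^sub>R e) \<bullet> grad g y) = (*) (\<Sum>i\<in>Basis. (e \<bullet> i) * partial_deriv i g y)" for y
    by (simp add: fun_eq_iff grad_def inner_sum_right sum_distrib_right sum_distrib_left mult_ac)
  ultimately show ?thesis
    by (simp add: has_field_derivative_def)
qed

text \<open>The limit is the Hessian form evaluated at \<open>e\<close>. General directions are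
  treated because a reflection moves the coordinate directions away from the basis.\<close>

lemma C2_second_diff_direction:
  assumes "C2 u"
  shows "((\<lambda>t. (u (x + t *\<^sub>R e) + u (x - t *\<^sub>R e) - 2 * u x) / t\<^sup>2)
      \<longlongrightarrow> (\<Sum>i\<in>Basis. \<Sum>j\<in>Basis. (e \<bullet> i) * (e \<bullet> j) * partial_deriv j (partial_deriv i u) x)) (at 0)"
proof -
  let ?\<phi>' = "\<lambda>t. \<Sum>i\<in>Basis. (e \<bullet> i) * partial_deriv i u (x + t *\<^sub>R e)"
  have "((\<lambda>t. u (x + t *\<^sub>R e)) has_real_derivative ?\<phi>' t) (at t)" for t
    using assms by (intro C1_line_derivative) (simp add: C2_def)
  moreover have "((\<lambda>t. partial_deriv i u (x + t *\<^sub>R e)) has_real_derivative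
      (\<Sum>j\<in>Basis. (e \<bullet> j) * partial_deriv j (partial_deriv i u) x)) (at 0)" if "i \<in> Basis" for i
    using C1_line_derivative[of "partial_deriv i u" x e 0] assms that by (simp add: C2_def)
  then have "(?\<phi>' has_real_derivative
      (\<Sum>i\<in>Basis. (e \<bullet> i) * (\<Sum>j\<in>Basis. (e \<bullet> j) * partial_deriv j (partial_deriv i u) x))) (at 0)"
    by (intro DERIV_sum DERIV_cmult)
  ultimately show ?thesis
    using second_diff_tendsto[of "\<lambda>t. u (x + t *\<^sub>R e)" ?\<phi>' _ 0]
    by (simp add: sum_distrib_left mult.assoc)
qed

section \<open>Reflections in hyperplanes and the invariance of the Laplacian\<close>

definition reflect :: "'a::real_inner \<Rightarrow> real \<Rightarrow> 'a \<Rightarrow> 'a" where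
  "reflect e l x = x + (2 * (l - e \<bullet> x)) *\<^sub>R e"

text \<open>The second difference of the reflected function along \<open>b\<close> is that of
  \<open>u\<close> along \<open>?R b\<close>, where \<open>?R\<close> is the linear part of the
  reflection. Since \<open>?R\<close> is orthogonal, summing over \<open>b\<close> gives the trace
  of the Hessian again.\<close>

lemma has_laplacian_reflect:
  assumes C2: "C2 u" and e: "norm e = 1"
  shows "has_laplacian (\<lambda>y. u (reflect e l y)) x (laplacian u (reflect e l x))"
proof -
  let ?R = "\<lambda>b. b - (2 * (e \<bullet> b)) *\<^sub>R e"
  let ?D = "\<lambda>i j. partial_deriv j (partial_deriv i u) (reflect e l x)"
  have ee: "e \<bullet> e = 1" using e by (simp add: norm_eq_1)
  have sym: "?R a \<bullet> b = a \<bullet> ?R b" for a b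
    by (simp add: inner_simps inner_commute)
  have iso: "?R a \<bullet> ?R b = a \<bullet> b" for a b
    by (simp add: inner_simps ee inner_commute)
  have "reflect e l (x + t *\<^sub>R b) = reflect e l x + t *\<^sub>R ?R b"
       "reflect e l (x - t *\<^sub>R b) = reflect e l x - t *\<^sub>R ?R b" for t b
    by (auto simp: reflect_def inner_simps algebra_simps)
  then have "has_laplacian (\<lambda>y. u (reflect e l y)) x
      (\<Sum>b\<in>Basis. \<Sum>i\<in>Basis. \<Sum>j\<in>Basis. (?R b \<bullet> i) * (?R b \<bullet> j) * ?D i j)"
    unfolding has_laplacian_def second_diff_def
    by (simp only:) (intro tendsto_sum C2_second_diff_direction C2)
  also have "(\<Sum>b\<in>Basis. \<Sum>i\<in>Basis. \<Sum>j\<in>Basis. (?R b \<bullet> i) * (?R b \<bullet> j) * ?D i j)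
      = (\<Sum>i\<in>Basis. \<Sum>b\<in>Basis. \<Sum>j\<in>Basis. (?R b \<bullet> i) * (?R b \<bullet> j) * ?D i j)"
    by (rule sum.swap)
  also have "\<dots> = (\<Sum>i\<in>Basis. \<Sum>j\<in>Basis. \<Sum>b\<in>Basis. (?R b \<bullet> i) * (?R b \<bullet> j) * ?D i j)"
    by (rule sum.cong[OF refl], rule sum.swap)
  also have "\<dots> = (\<Sum>i\<in>Basis. \<Sum>j\<in>Basis. (i \<bullet> j) * ?D i j)"
  proof (intro sum.cong refl)
    fix i j
    \<comment> \<open>Self-adjointness moves \<open>?R\<close> onto \<open>i\<close> and
      \<open>j\<close>, so the sum becomes an inner product expanded in the basis; the isometry
      property then reduces it to \<open>i \<bullet> j\<close>.\<close>
    have "(\<Sum>b\<in>Basis. (?R b \<bullet> i) * (?R b \<bullet> j)) = ?R i \<bullet> ?R j"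
      unfolding euclidean_inner[of "?R i" "?R j"] by (intro sum.cong refl) (metis inner_commute sym)
    then show "(\<Sum>b\<in>Basis. (?R b \<bullet> i) * (?R b \<bullet> j) * ?D i j) = (i \<bullet> j) * ?D i j"
      by (simp add: sum_distrib_right[symmetric] iso del: inner_diff_left inner_diff_right)
  qed
  also have "\<dots> = (\<Sum>i\<in>Basis. \<Sum>j\<in>Basis. if i = j then ?D i j else 0)"
    by (intro sum.cong) (auto simp: inner_Basis)
  also have "\<dots> = laplacian u (reflect e l x)"
    by (simp add: laplacian_def)
  finally show ?thesis .
qed

lemma C2_has_laplacian:
  assumes "C2 u"
  shows "has_laplacian u x (laplacian u x)"
proof -
  have "has_laplacian u x (\<Sum>b\<in>Basis. \<Sum>i\<in>Basis. \<Sum>j\<in>Basis.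
      (b \<bullet> i) * (b \<bullet> j) * partial_deriv j (partial_deriv i u) x)"
    unfolding has_laplacian_def second_diff_def
    by (intro tendsto_sum C2_second_diff_direction assms)
  also have "(\<Sum>b\<in>Basis. \<Sum>i\<in>Basis. \<Sum>j\<in>Basis.
      (b \<bullet> i) * (b \<bullet> j) * partial_deriv j (partial_deriv i u) x)
    = (\<Sum>b\<in>Basis. \<Sum>i\<in>Basis. if b = i then \<Sum>j\<in>Basis. if b = j then partial_deriv j (partial_deriv i u) x else 0 else 0)"
    by (intro sum.cong refl) (simp add: inner_Basis if_distrib[of "\<lambda>a. a * _"] cong: if_cong)
  also have "\<dots> = laplacian u x"
    by (simp add: laplacian_def)
  finally show ?thesis .
qed

lemma C2_continuous: "C2 u \<Longrightarrow> continuous_on S u"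
  by (auto simp: C2_def C1_def intro!: continuous_at_imp_continuous_on differentiable_imp_continuous_within)

lemma has_laplacian_real:
  fixes v :: "real \<Rightarrow> real"
  assumes "\<And>t. (v has_real_derivative v' t) (at t)" "(v' has_real_derivative c) (at x)"
  shows "has_laplacian v x c"
  using second_diff_tendsto[OF assms] by (simp add: has_laplacian_def second_diff_def[abs_def])

lemma sum_Basis_prod_real:
  fixes F :: "'a::euclidean_space \<times> real \<Rightarrow> real"
  shows "(\<Sum>b\<in>Basis. F b) = (\<Sum>b\<in>Basis. F (b, 0)) + F (0, 1)"
proof -
  have "inj_on (\<lambda>b. (b :: 'a, 0 :: real)) Basis"
    by (simp add: inj_on_def)
  then show ?thesis
    unfolding Basis_prod_def by (subst sum.union_disjoint) (auto simp: sum.reindex)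
qed

lemma has_laplacian_snd:
  fixes V :: "real \<Rightarrow> real" and x :: "'a::euclidean_space \<times> real"
  assumes "\<And>t. (V has_real_derivative V' t) (at t)" "(V' has_real_derivative c) (at (snd x))"
  shows "has_laplacian (\<lambda>y. V (snd y)) x c"
  using second_diff_tendsto[OF assms]
  by (simp add: has_laplacian_def second_diff_def[abs_def] sum_Basis_prod_real)

section \<open>Maximum principles\<close>

text \<open>The barrier is \<open>q\<^sup>2 + 2 \<eta> q\<close> with \<open>q = r\<^sup>2 - |x - z|\<^sup>2\<close>, a strict subsolution of
  \<open>\<Delta> v = L v\<close> on the thin shell \<open>0 \<le> q \<le> \<eta>\<close>; being a polynomial, it has an explicit Laplacian.\<close>

lemma hopf_barrier:
  fixes w :: "'a::euclidean_space \<Rightarrow> real"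
  assumes r: "0 < r" and L: "0 \<le> L"
    and cont: "continuous_on (cball z r) w"
    and lap: "\<And>x. x \<in> ball z r \<Longrightarrow> \<exists>K. has_laplacian w x K \<and> K \<le> L * w x"
    and pos: "\<And>x. x \<in> ball z r \<Longrightarrow> 0 < w x"
    and nonneg: "\<And>x. x \<in> cball z r \<Longrightarrow> 0 \<le> w x"
  obtains c \<eta> where "0 < c" "0 < \<eta>"
    "\<And>x. x \<in> cball z r \<Longrightarrow> r\<^sup>2 - (norm (x - z))\<^sup>2 \<le> \<eta> \<Longrightarrow> c * (r\<^sup>2 - (norm (x - z))\<^sup>2) \<le> w x"
proof -
  define N where "N = real DIM('a)"
  have N: "0 < N" by (simp add: N_def)
  \<comment> \<open>With \<open>\<eta> \<le> 1\<close> one has \<open>v x \<le> 3 * \<eta>\<close>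
    on the shell. In the denominator, \<open>3 * L\<close> absorbs \<open>L * v x\<close>,
    \<open>8\<close> absorbs the loss in \<open>s x = r\<^sup>2 - q x\<close>, and
    \<open>8 * N\<close> absorbs the two terms \<open>4 * N * q x\<close> and
    \<open>4 * N * \<eta>\<close>.\<close>
  define \<eta> where "\<eta> = min (min 1 (r\<^sup>2 / 2)) (4 * r\<^sup>2 / (8 + 8 * N + 3 * L))"
  have D: "0 < 8 + 8 * N + 3 * L" using N L by simp
  have \<eta>: "0 < \<eta>" "\<eta> \<le> 1" "\<eta> < r\<^sup>2" "(8 + 8 * N + 3 * L) * \<eta> < 8 * r\<^sup>2"
  proof -
    show "0 < \<eta>" "\<eta> \<le> 1" using r D by (auto simp: \<eta>_def)
    have "\<eta> \<le> r\<^sup>2 / 2" by (simp add: \<eta>_def)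
    also have "\<dots> < r\<^sup>2" using r by simp
    finally show "\<eta> < r\<^sup>2" .
    have "\<eta> \<le> 4 * r\<^sup>2 / (8 + 8 * N + 3 * L)" by (simp add: \<eta>_def)
    then have "(8 + 8 * N + 3 * L) * \<eta> \<le> 4 * r\<^sup>2"
      using D by (simp add: field_simps)
    also have "\<dots> < 8 * r\<^sup>2" using r by simp
    finally show "(8 + 8 * N + 3 * L) * \<eta> < 8 * r\<^sup>2" .
  qed
  define s where "s = (\<lambda>x. (norm (x - z))\<^sup>2)"
  define q where "q = (\<lambda>x. r\<^sup>2 - s x)"
  define v where "v = (\<lambda>x. (q x)\<^sup>2 + 2 * \<eta> * q x)"
  have v_alt: "v = (\<lambda>x. ((s x)\<^sup>2 - (2 * r\<^sup>2 + 2 * \<eta>) * s x) + (r\<^sup>2 * r\<^sup>2 + 2 * \<eta> * r\<^sup>2))"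
    by (auto simp: v_def q_def power2_eq_square algebra_simps)
  have lapv: "has_laplacian v x (8 * s x - 4 * N * q x - 4 * N * \<eta>)" for x
  proof -
    have "has_laplacian v x (((4 * DIM('a) + 8) * s x - (2 * r\<^sup>2 + 2 * \<eta>) * (2 * DIM('a))) + 0)"
      unfolding v_alt s_def
      by (intro has_laplacian_add has_laplacian_diff has_laplacian_cmult has_laplacian_const
          has_laplacian_norm_sq has_laplacian_norm_pow4)
    moreover have "((4 * DIM('a) + 8) * s x - (2 * r\<^sup>2 + 2 * \<eta>) * (2 * DIM('a))) + 0
        = 8 * s x - 4 * N * q x - 4 * N * \<eta>"
      by (simp add: N_def q_def algebra_simps)
    ultimately show ?thesis by metis
  qed
  have lapv_gt: "L * v x < 8 * s x - 4 * N * q x - 4 * N * \<eta>" if "0 \<le> q x" "q x \<le> \<eta>" for x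
  proof -
    have "(q x)\<^sup>2 \<le> 1 * \<eta>"
      unfolding power2_eq_square using that \<eta> by (intro mult_mono) auto
    moreover have "\<eta> * q x \<le> \<eta> * 1"
      using that \<eta> by (intro mult_left_mono) auto
    ultimately have "L * v x \<le> L * (3 * \<eta>)"
      using L by (intro mult_left_mono) (auto simp: v_def)
    moreover have "N * q x \<le> N * \<eta>"
      using that N by (intro mult_left_mono) auto
    moreover have "s x = r\<^sup>2 - q x" by (simp add: q_def)
    ultimately show ?thesis using \<eta>(4) that by (simp add: algebra_simps)
  qed
  define A where "A = {x \<in> cball z r. q x \<le> \<eta>}"
  have contq: "continuous_on S q" for S
    unfolding q_def s_def by (intro continuous_intros)
  have in_cball: "x \<in> cball z r \<longleftrightarrow> 0 \<le> q x" "x \<in> ball z r \<longleftrightarrow> 0 < q x" for x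
    using r
    by (auto simp: q_def s_def dist_norm norm_minus_commute power_mono_iff
        intro: power_strict_mono power2_less_imp_less)
  have A_eq: "A = {x. 0 \<le> q x \<and> q x \<le> \<eta>}" unfolding A_def in_cball by auto
  \<comment> \<open>The inner boundary of the shell is a compact subset of the open ball, so
    \<open>w\<close> has a positive lower bound \<open>\<mu>\<close> there.\<close>
  define A1 where "A1 = {x. q x = \<eta>}"
  have "closed A1" unfolding A1_def
    using continuous_closed_preimage_constant[OF contq[of UNIV] closed_UNIV, of \<eta>] by simp
  have A1sub: "A1 \<subseteq> ball z r" using \<eta> unfolding A1_def subset_iff in_cball by auto
  have "compact A1"
    unfolding compact_eq_bounded_closed using \<open>closed A1\<close> A1sub bounded_ball bounded_subset by blast
  have contw: "continuous_on A1 w"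
    using cont A1sub by (meson ball_subset_cball continuous_on_subset)
  obtain \<mu> where \<mu>: "0 < \<mu>" "\<And>x. x \<in> A1 \<Longrightarrow> \<mu> \<le> w x"
  proof (cases "A1 = {}")
    case True
    then show ?thesis using that[of 1] by auto
  next
    case False
    then obtain x0 where "x0 \<in> A1" "\<forall>y\<in>A1. w x0 \<le> w y"
      using continuous_attains_inf[OF \<open>compact A1\<close> _ contw] by blast
    then show ?thesis using that[of "w x0"] pos A1sub by auto
  qed
  \<comment> \<open>On \<open>A1\<close> the barrier equals \<open>3 * \<eta>\<^sup>2\<close>, so
    \<open>\<delta> * v\<close> equals \<open>\<mu>\<close> there.\<close>
  define \<delta> where "\<delta> = \<mu> / (3 * \<eta>\<^sup>2)"
  have \<delta>: "0 < \<delta>" using \<mu> \<eta> by (simp add: \<delta>_def)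
  \<comment> \<open>A negative minimum of \<open>w - \<delta> * v\<close> over the shell lies in its
    interior: on the outer sphere \<open>v\<close> vanishes and \<open>w\<close> is nonnegative, on
    the inner one the choice of \<open>\<delta>\<close> applies. There the second-derivative test
    contradicts the strict subsolution property.\<close>
  have key: "\<delta> * v x \<le> w x" if "x \<in> A" for x
  proof (rule ccontr)
    assume neg: "\<not> \<delta> * v x \<le> w x"
    have "closed {x. q x \<le> \<eta>}"
      by (intro closed_Collect_le contq continuous_on_const)
    then have "compact A"
      using compact_Int_closed[OF compact_cball, of "{x. q x \<le> \<eta>}" z r] by (simp add: A_def Int_def)
    moreover have "continuous_on A (\<lambda>x. w x - \<delta> * v x)"
      unfolding v_def by (intro continuous_intros contq continuous_on_subset[OF cont]) (auto simp: A_def)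
    ultimately obtain p where p: "p \<in> A" "\<And>y. y \<in> A \<Longrightarrow> w p - \<delta> * v p \<le> w y - \<delta> * v y"
      using continuous_attains_inf[of A "\<lambda>x. w x - \<delta> * v x"] \<open>x \<in> A\<close> by auto
    have pneg: "w p - \<delta> * v p < 0" using p(2)[OF \<open>x \<in> A\<close>] neg by simp
    have "q p \<noteq> 0"
      using pneg nonneg[of p] p(1) by (auto simp: v_def A_def)
    moreover have "q p \<noteq> \<eta>"
    proof
      assume "q p = \<eta>"
      then have "\<mu> \<le> w p" "\<delta> * v p = \<mu>"
        using \<mu> \<eta> by (auto simp: A1_def v_def \<delta>_def power2_eq_square)
      then show False using pneg by simp
    qed
    ultimately have qp: "0 < q p" "q p < \<eta>" using p(1) by (auto simp: A_eq)
    have "isCont q p" using contq[of UNIV] by (simp add: continuous_on_eq_continuous_at)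
    then have "\<forall>\<^sub>F y in nhds p. 0 < q y \<and> q y < \<eta>"
      using qp unfolding isCont_def tendsto_at_iff_tendsto_nhds
      by (intro eventually_conj) (auto dest: order_tendstoD)
    then have "\<forall>\<^sub>F y in nhds p. w p - \<delta> * v p \<le> w y - \<delta> * v y"
      by eventually_elim (use p(2) in \<open>auto simp: A_eq\<close>)
    moreover obtain K where K: "has_laplacian w p K" "K \<le> L * w p"
      using lap qp in_cball by blast
    ultimately have "0 \<le> K - \<delta> * (8 * s p - 4 * N * q p - 4 * N * \<eta>)"
      by (blast intro: has_laplacian_local_min[OF has_laplacian_diff[OF _ has_laplacian_cmult[OF lapv]]])
    moreover have "\<delta> * (L * v p) < \<delta> * (8 * s p - 4 * N * q p - 4 * N * \<eta>)"
      using lapv_gt[of p] qp \<delta> by simp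
    ultimately have "0 < L * (w p - \<delta> * v p)"
      using K(2) by (simp add: algebra_simps)
    then show False using pneg L by (simp add: zero_less_mult_iff)
  qed
  \<comment> \<open>Dropping the square in \<open>v\<close> leaves the linear bound with slope
    \<open>2 * \<eta>\<close>.\<close>
  show ?thesis
  proof (rule that[of "\<delta> * (2 * \<eta>)" \<eta>])
    fix x
    assume "x \<in> cball z r" "r\<^sup>2 - (norm (x - z))\<^sup>2 \<le> \<eta>"
    then have "\<delta> * v x \<le> w x" by (intro key) (simp add: A_def q_def s_def)
    moreover have "2 * \<eta> * q x \<le> v x" by (simp add: v_def)
    then have "\<delta> * (2 * \<eta> * q x) \<le> \<delta> * v x" using \<delta> by simp
    ultimately show "\<delta> * (2 * \<eta>) * (r\<^sup>2 - (norm (x - z))\<^sup>2) \<le> w x"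
      by (simp add: q_def s_def mult.assoc)
  qed (use \<delta> \<eta> in auto)
qed

text \<open>The barrier grows linearly along the inward radius from \<open>p\<close>, so the
  difference quotients in the direction \<open>z - p\<close> stay above
  \<open>c * r\<^sup>2\<close>.\<close>

lemma hopf_lemma:
  fixes w :: "'a::euclidean_space \<Rightarrow> real"
  assumes r: "0 < r" and L: "0 \<le> L"
    and cont: "continuous_on (cball z r) w"
    and lap: "\<And>x. x \<in> ball z r \<Longrightarrow> \<exists>K. has_laplacian w x K \<and> K \<le> L * w x"
    and pos: "\<And>x. x \<in> ball z r \<Longrightarrow> 0 < w x"
    and p: "norm (p - z) = r" "w p = 0"
    and diff: "(w has_derivative w') (at p)"
    and nonneg: "\<And>x. x \<in> cball z r \<Longrightarrow> 0 \<le> w x"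
  shows "0 < w' (z - p)"
proof -
  obtain c \<eta> where c: "0 < c" "0 < \<eta>"
    "\<And>x. x \<in> cball z r \<Longrightarrow> r\<^sup>2 - (norm (x - z))\<^sup>2 \<le> \<eta> \<Longrightarrow> c * (r\<^sup>2 - (norm (x - z))\<^sup>2) \<le> w x"
    using hopf_barrier[OF r L cont lap pos nonneg] by blast
  have "((\<lambda>t. w (p + t *\<^sub>R (z - p))) has_derivative (\<lambda>t. w' (t *\<^sub>R (z - p)))) (at 0)"
    by (rule has_derivative_compose[where g = w and g' = w'])
       (use diff in \<open>auto intro!: derivative_eq_intros\<close>)
  moreover have "(\<lambda>t. w' (t *\<^sub>R (z - p))) = (*) (w' (z - p))"
    using has_derivative_linear[OF diff] by (auto simp: linear_cmul fun_eq_iff)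
  ultimately have "((\<lambda>t. w (p + t *\<^sub>R (z - p))) has_real_derivative w' (z - p)) (at 0)"
    by (simp add: has_field_derivative_def)
  then have "((\<lambda>t. w (p + t *\<^sub>R (z - p)) / t) \<longlongrightarrow> w' (z - p)) (at 0)"
    by (simp add: has_field_derivative_iff p)
  then have lim: "((\<lambda>t. w (p + t *\<^sub>R (z - p)) / t) \<longlongrightarrow> w' (z - p)) (at_right 0)"
    by (rule filterlim_mono) (auto simp: at_le)
  \<comment> \<open>For \<open>t < \<tau>\<close> the point has not reached the centre, and it lies
    in the shell where the barrier bound holds, because
    \<open>r\<^sup>2 * (2 * t - t\<^sup>2)\<close> is at most
    \<open>2 * t * r\<^sup>2\<close>.\<close>
  define \<tau> where "\<tau> = min 1 (\<eta> / (2 * r\<^sup>2))"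
  have \<tau>: "0 < \<tau>" using r c by (simp add: \<tau>_def)
  have "\<forall>\<^sub>F t in at_right 0. c * r\<^sup>2 \<le> w (p + t *\<^sub>R (z - p)) / t"
    unfolding eventually_at_right_field
  proof (intro exI[of _ \<tau>] conjI allI impI \<tau>)
    fix t :: real
    assume t: "0 < t" "t < \<tau>"
    then have t1: "t < 1" "t * (2 * r\<^sup>2) < \<eta>"
      using r by (auto simp: \<tau>_def field_simps)
    let ?x = "p + t *\<^sub>R (z - p)"
    have "?x - z = (1 - t) *\<^sub>R (p - z)" by (simp add: algebra_simps)
    then have n: "norm (?x - z) = (1 - t) * r" using p t1 by simp
    have e: "r\<^sup>2 - (norm (?x - z))\<^sup>2 = r\<^sup>2 * (2 * t - t\<^sup>2)"
      unfolding n by (simp add: power2_eq_square algebra_simps)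
    have "t\<^sup>2 \<le> t" using t t1 by (simp add: power2_eq_square mult_left_le)
    then have b: "r\<^sup>2 * t \<le> r\<^sup>2 * (2 * t - t\<^sup>2)" by (intro mult_left_mono) auto
    have "r\<^sup>2 * (2 * t - t\<^sup>2) \<le> t * (2 * r\<^sup>2)" by (simp add: algebra_simps)
    then have "r\<^sup>2 * (2 * t - t\<^sup>2) \<le> \<eta>" using t1 by linarith
    then have "c * (r\<^sup>2 * (2 * t - t\<^sup>2)) \<le> w ?x"
      using c(3)[of ?x] n t t1 r unfolding e
      by (simp add: dist_norm norm_minus_commute mult_left_le_one_le)
    then have "c * (r\<^sup>2 * t) \<le> w ?x" using b c(1) by (meson mult_left_mono less_imp_le order_trans)
    then show "c * r\<^sup>2 \<le> w ?x / t" using t by (simp add: field_simps)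
  qed
  then have "c * r\<^sup>2 \<le> w' (z - p)"
    using lim by (intro tendsto_lowerbound[OF lim]) auto
  moreover have "0 < c * r\<^sup>2" using c r by simp
  ultimately show ?thesis by linarith
qed

text \<open>If \<open>w y\<close> were nonzero, let \<open>q\<close> be a zero nearest to
  \<open>y\<close>. The ball about \<open>y\<close> reaching to \<open>q\<close> contains no zero in
  its interior, so Hopf's lemma gives a nonzero derivative at \<open>q\<close>, although
  \<open>q\<close> is an interior minimum. The radius \<open>2 * \<rho>\<close> leaves room for this
  ball.\<close>

lemma strong_maximum_principle_local:
  fixes w :: "'a::euclidean_space \<Rightarrow> real"
  assumes \<rho>: "0 < \<rho>" and L: "0 \<le> L"
    and diff: "\<And>x. x \<in> ball p (2 * \<rho>) \<Longrightarrow> w differentiable at x"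
    and lap: "\<And>x. x \<in> ball p (2 * \<rho>) \<Longrightarrow> \<exists>K. has_laplacian w x K \<and> K \<le> L * w x"
    and nonneg: "\<And>x. x \<in> ball p (2 * \<rho>) \<Longrightarrow> 0 \<le> w x"
    and p: "w p = 0" and y: "y \<in> ball p \<rho>"
  shows "w y = 0"
proof (rule ccontr)
  assume wy: "w y \<noteq> 0"
  have dyp: "dist y p < \<rho>" using y by (simp add: dist_commute)
  have sub: "cball y (dist y p) \<subseteq> ball p (2 * \<rho>)"
  proof
    fix x assume "x \<in> cball y (dist y p)"
    then show "x \<in> ball p (2 * \<rho>)"
      using dist_triangle[of p x y] dyp by (simp add: dist_commute)
  qed
  have cont: "continuous_on (cball y (dist y p)) w"
    using diff sub by (meson continuous_at_imp_continuous_on differentiable_imp_continuous_within subsetD)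
  define Z where "Z = {x \<in> cball y (dist y p). w x = 0}"
  have "compact Z"
  proof -
    have "closed Z" unfolding Z_def
      using continuous_closed_preimage_constant[OF cont closed_cball] by simp
    then show ?thesis
      unfolding compact_eq_bounded_closed Z_def by (auto intro: bounded_subset[OF bounded_cball])
  qed
  moreover have "p \<in> Z" using p by (simp add: Z_def)
  ultimately obtain q where q: "q \<in> Z" "\<And>x. x \<in> Z \<Longrightarrow> dist y q \<le> dist y x"
    using continuous_attains_inf[of Z "dist y"] continuous_on_dist[OF continuous_on_const continuous_on_id, of Z y]
    by (auto simp: id_def)
  define r where "r = dist y q"
  have r_le: "r \<le> dist y p" using q(2)[OF \<open>p \<in> Z\<close>] by (simp add: r_def)
  have r: "0 < r" using q(1) wy by (auto simp: r_def Z_def)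
  have subr: "cball y r \<subseteq> ball p (2 * \<rho>)" using sub r_le by (meson order_trans subset_cball)
  obtain w' where w': "(w has_derivative w') (at q)"
    using diff[of q] subr q(1) unfolding differentiable_def by (force simp: r_def Z_def)
  have pos: "0 < w x" if "x \<in> ball y r" for x
  proof -
    have "x \<notin> Z" using q(2)[of x] that by (auto simp: r_def)
    moreover have "x \<in> cball y (dist y p)" using that r_le by simp
    ultimately show ?thesis using nonneg[of x] sub by (auto simp: Z_def less_le)
  qed
  have qin: "q \<in> ball p (2 * \<rho>)" using subr by (auto simp: r_def)
  have "0 < w' (y - q)"
  proof (rule hopf_lemma[OF r L _ _ pos _ _ w'])
    show "continuous_on (cball y r) w" using cont r_le by (meson continuous_on_subset subset_cball)
    show "norm (q - y) = r" by (simp add: r_def dist_norm norm_minus_commute)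
    show "w q = 0" using q(1) by (simp add: Z_def)
  qed (use subr lap nonneg ball_subset_cball in blast)+
  moreover have "w' (y - q) = 0"
  proof -
    have "w' = (\<lambda>h. 0)"
      by (rule differential_zero_maxmin[OF qin open_ball w'])
         (use q(1) nonneg in \<open>auto simp: Z_def\<close>)
    then show ?thesis by simp
  qed
  ultimately show False by simp
qed

text \<open>The set where \<open>w = m\<close> is open by the local version and closed by
  continuity. The differential inequality is asked for only near points of this set, with
  \<open>L\<close> depending on the point, because in the moving plane argument it is known only
  near a negative minimum.\<close>

lemma strong_maximum_principle:
  fixes w :: "'a::euclidean_space \<Rightarrow> real"
  assumes S: "open S" "connected S" and p: "p \<in> S" "w p = m"
    and diff: "\<And>x. x \<in> S \<Longrightarrow> w differentiable at x"
    and ge: "\<And>x. x \<in> S \<Longrightarrow> m \<le> w x"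
    and lap: "\<And>x. x \<in> S \<Longrightarrow> w x = m \<Longrightarrow>
       \<exists>L\<ge>0. \<forall>\<^sub>F y in nhds x. \<exists>K. has_laplacian w y K \<and> K \<le> L * (w y - m)"
    and x: "x \<in> S"
  shows "w x = m"
proof -
  define Z where "Z = {x \<in> S. w x = m}"
  have "\<exists>e>0. ball x e \<subseteq> Z" if "x \<in> Z" for x
  proof -
    have xS: "x \<in> S" "w x = m" using that by (auto simp: Z_def)
    obtain L where L: "L \<ge> 0" "\<forall>\<^sub>F y in nhds x. \<exists>K. has_laplacian w y K \<and> K \<le> L * (w y - m)"
      using lap[OF xS] by blast
    moreover have "\<forall>\<^sub>F y in nhds x. y \<in> S" using S xS by (simp add: eventually_nhds_in_open)
    ultimately have "\<forall>\<^sub>F y in nhds x. y \<in> S \<and> (\<exists>K. has_laplacian w y K \<and> K \<le> L * (w y - m))"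
      by (auto elim: eventually_elim2)
    then obtain d where d: "d > 0" "\<And>y. dist y x < d \<Longrightarrow> y \<in> S \<and> (\<exists>K. has_laplacian w y K \<and> K \<le> L * (w y - m))"
      unfolding eventually_nhds_metric by blast
    have in_S: "y \<in> S" if "y \<in> ball x (2 * (d / 2))" for y
      using d(2)[of y] that by (simp add: dist_commute)
    have "w y - m = 0" if y: "y \<in> ball x (d / 2)" for y
    proof (rule strong_maximum_principle_local[where w = "\<lambda>y. w y - m" and \<rho> = "d / 2", OF _ L(1) _ _ _ _ y])
      fix y assume y: "y \<in> ball x (2 * (d / 2))"
      show "(\<lambda>y. w y - m) differentiable at y" using diff[OF in_S[OF y]] by simp
      show "0 \<le> w y - m" using ge[OF in_S[OF y]] by simp
      obtain K where "has_laplacian w y K" "K \<le> L * (w y - m)"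
        using d(2)[of y] y by (auto simp: dist_commute)
      then show "\<exists>K. has_laplacian (\<lambda>y. w y - m) y K \<and> K \<le> L * (w y - m)"
        using has_laplacian_diff[OF _ has_laplacian_const] by fastforce
    qed (use d xS in auto)
    then have "ball x (d / 2) \<subseteq> Z"
      using in_S d(1) by (auto simp: Z_def)
    then show ?thesis using d(1) by (intro exI[of _ "d / 2"]) auto
  qed
  then have "open Z" unfolding open_contains_ball by blast
  then have "openin (top_of_set S) Z"
    by (auto simp: openin_open_eq S Z_def)
  moreover have "closedin (top_of_set S) Z"
    unfolding Z_def
    by (rule continuous_closedin_preimage_constant)
       (use diff in \<open>meson continuous_at_imp_continuous_on differentiable_imp_continuous_within\<close>)
  moreover have "p \<in> Z" using p by (simp add: Z_def)
  ultimately have "Z = S"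
    using S(2) unfolding connected_clopen by blast
  then show ?thesis using x by (auto simp: Z_def)
qed

section \<open>Interior Lipschitz bound\<close>

lemma reflect_fixed: "e \<bullet> x = l \<Longrightarrow> reflect e l x = x"
  by (simp add: reflect_def)

text \<open>Compare the odd part of \<open>u\<close> across the hyperplane through \<open>x\<close> orthogonal to \<open>e\<close> with a quadratic
  barrier on a half ball; this gives a gradient bound from the maximum principle alone.\<close>

lemma C2_symmetric_difference_bound:
  fixes u :: "'a::euclidean_space \<Rightarrow> real"
  assumes C2: "C2 u" and M: "\<And>x. \<bar>u x\<bar> \<le> M" and N: "\<And>x. \<bar>laplacian u x\<bar> \<le> N"
    and e: "norm e = 1" and s: "0 \<le> s" "s \<le> 1"
  shows "u (x + s *\<^sub>R e) - u (x - s *\<^sub>R e) \<le> (2 * M + 2 * M * DIM('a) + N + 1) * s"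
proof -
  define c where "c = e \<bullet> x"
  \<comment> \<open>Chosen so that the Laplacian of \<open>\<psi>\<close> is exactly
    \<open>- 2 * (N + 1)\<close>, whatever the dimension.\<close>
  define Q where "Q = 2 * M * DIM('a) + (N + 1)"
  \<comment> \<open>With \<open>\<tau> = e \<bullet> z - c\<close> the second term is
    \<open>Q * (\<tau> * (1 - \<tau>))\<close>; it is expanded in powers of
    \<open>e \<bullet> z\<close> so that the Laplacian rules apply.\<close>
  define \<psi> where "\<psi> = (\<lambda>z. 2 * M * (norm (z - x))\<^sup>2 + Q * ((1 + 2 * c) * (e \<bullet> z) - (e \<bullet> z)\<^sup>2 + (- c - c\<^sup>2)))"
  define \<phi> where "\<phi> = (\<lambda>z. u z - u (reflect e c z))"
  have ee: "e \<bullet> e = 1" using e by (simp add: norm_eq_1)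
  have M0: "0 \<le> M" and N0: "0 \<le> N" using M[of x] N[of x] by linarith+
  have Q0: "0 \<le> Q" using M0 N0 by (simp add: Q_def)
  have \<psi>_eq: "\<psi> z = 2 * M * (norm (z - x))\<^sup>2 + Q * ((e \<bullet> z - c) * (1 - (e \<bullet> z - c)))" for z
    by (simp add: \<psi>_def power2_eq_square algebra_simps)
  have lap\<psi>: "has_laplacian \<psi> z (- 2 * (N + 1))" for z
  proof -
    have "has_laplacian \<psi> z (2 * M * (2 * DIM('a)) + Q * ((1 + 2 * c) * 0 - 2 * (norm e)\<^sup>2 + 0))"
      unfolding \<psi>_def
      by (intro has_laplacian_add has_laplacian_diff has_laplacian_cmult has_laplacian_norm_sq
          has_laplacian_inner has_laplacian_inner_sq has_laplacian_const)
    then show ?thesis using e by (simp add: Q_def algebra_simps)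
  qed
  define D where "D = cball x 1 \<inter> {z. c \<le> e \<bullet> z}"
  have "compact D"
    unfolding D_def by (intro compact_Int_closed compact_cball closed_Collect_le continuous_intros)
  have range: "0 \<le> e \<bullet> z - c" "e \<bullet> z - c \<le> 1" if "z \<in> D" for z
  proof -
    show "0 \<le> e \<bullet> z - c" using that by (simp add: D_def)
    have "e \<bullet> z - c = e \<bullet> (z - x)" by (simp add: c_def inner_diff_right)
    also have "\<dots> \<le> norm e * norm (z - x)" by (rule norm_cauchy_schwarz)
    also have "\<dots> \<le> 1" using that e by (simp add: D_def dist_norm norm_minus_commute)
    finally show "e \<bullet> z - c \<le> 1" .
  qed
  have \<psi>_ge: "2 * M * (norm (z - x))\<^sup>2 \<le> \<psi> z" if "z \<in> D" for z
    unfolding \<psi>_eq using range[OF that] Q0 by simp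
  have contu: "continuous_on S u" for S using C2 by (rule C2_continuous)
  have cont: "continuous_on D (\<lambda>z. \<psi> z - \<phi> z)"
    unfolding \<psi>_def \<phi>_def reflect_def
    by (intro continuous_intros continuous_on_compose2[OF contu[of UNIV]]) auto
  \<comment> \<open>On the spherical part of the boundary \<open>\<psi>\<close> is at least
    \<open>2 * M\<close>, which dominates \<open>\<phi>\<close>; on the flat part
    \<open>\<phi>\<close> vanishes. Inside, the Laplacian of \<open>\<psi> - \<phi>\<close> is at
    most \<open>- 2 * (N + 1) + 2 * N < 0\<close>, which rules out a minimum.\<close>
  have main: "0 \<le> \<psi> z - \<phi> z" if z: "z \<in> D" for z
  proof (rule ccontr)
    assume neg: "\<not> 0 \<le> \<psi> z - \<phi> z"
    obtain p where p: "p \<in> D" "\<And>y. y \<in> D \<Longrightarrow> \<psi> p - \<phi> p \<le> \<psi> y - \<phi> y"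
      using continuous_attains_inf[OF \<open>compact D\<close> _ cont] z by blast
    have pneg: "\<psi> p - \<phi> p < 0" using p(2)[OF z] neg by simp
    have "norm (p - x) \<noteq> 1"
    proof
      assume "norm (p - x) = 1"
      then have "2 * M \<le> \<psi> p" using \<psi>_ge[OF p(1)] by simp
      moreover have "\<phi> p \<le> 2 * M" using M[of p] M[of "reflect e c p"] by (simp add: \<phi>_def)
      ultimately show False using pneg by simp
    qed
    then have p1: "p \<in> ball x 1"
      using p(1) by (auto simp: D_def dist_norm norm_minus_commute less_le)
    have "e \<bullet> p \<noteq> c"
    proof
      assume "e \<bullet> p = c"
      then have "\<phi> p = 0" by (simp add: \<phi>_def reflect_fixed)
      moreover have "0 \<le> 2 * M * (norm (p - x))\<^sup>2" using M0 by simp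
      ultimately show False using pneg \<psi>_ge[OF p(1)] by simp
    qed
    then have p2: "c < e \<bullet> p" using range(1)[OF p(1)] by simp
    have "open (ball x 1 \<inter> {z. c < e \<bullet> z})"
      by (intro open_Int open_ball open_Collect_less continuous_intros)
    then have "\<forall>\<^sub>F y in nhds p. y \<in> ball x 1 \<inter> {z. c < e \<bullet> z}"
      using p1 p2 by (intro eventually_nhds_in_open) auto
    then have min: "\<forall>\<^sub>F y in nhds p. \<psi> p - \<phi> p \<le> \<psi> y - \<phi> y"
      by eventually_elim (use p(2) in \<open>auto simp: D_def\<close>)
    have "has_laplacian \<phi> p (laplacian u p - laplacian u (reflect e c p))"
      unfolding \<phi>_def by (intro has_laplacian_diff C2_has_laplacian has_laplacian_reflect C2 e)
    then have "0 \<le> - 2 * (N + 1) - (laplacian u p - laplacian u (reflect e c p))"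
      by (rule has_laplacian_local_min[OF has_laplacian_diff[OF lap\<psi>] min])
    moreover have "- N \<le> laplacian u p" "laplacian u (reflect e c p) \<le> N"
      using N[of p] N[of "reflect e c p"] by (auto simp: abs_le_iff)
    ultimately show False by (simp add: algebra_simps)
  qed
  let ?z = "x + s *\<^sub>R e"
  have ez: "e \<bullet> ?z = c + s" by (simp add: inner_simps ee c_def)
  have "?z \<in> D" using s e ez by (simp add: D_def dist_norm)
  then have "\<phi> ?z \<le> \<psi> ?z" using main by fastforce
  moreover have "reflect e c ?z = x - s *\<^sub>R e"
    unfolding reflect_def ez by (simp add: algebra_simps flip: scaleR_add_left)
  moreover have "\<psi> ?z \<le> (2 * M + Q) * s"
  proof -
    have "s\<^sup>2 \<le> s" "s * (1 - s) \<le> s" using s by (auto simp: power2_eq_square mult_left_le)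
    then have "2 * M * s\<^sup>2 + Q * (s * (1 - s)) \<le> 2 * M * s + Q * s"
      using M0 Q0 by (intro add_mono mult_left_mono) auto
    then show ?thesis unfolding \<psi>_eq ez using s e by (simp add: algebra_simps)
  qed
  ultimately show ?thesis by (simp add: \<phi>_def Q_def algebra_simps)
qed

text \<open>Points at distance less than 2 are symmetric about their midpoint, so the previous bound
  applies; for points farther apart the trivial bound \<open>2 * M\<close> suffices.\<close>

lemma C2_bounded_laplacian_lipschitz:
  fixes u :: "'a::euclidean_space \<Rightarrow> real"
  assumes C2: "C2 u" and M: "\<And>x. \<bar>u x\<bar> \<le> M" and N: "\<And>x. \<bar>laplacian u x\<bar> \<le> N"
  obtains C where "0 < C" "\<And>x y. \<bar>u x - u y\<bar> \<le> C * norm (x - y)"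
proof -
  define C where "C = 2 * M + 2 * M * DIM('a) + N + 1"
  have M0: "0 \<le> M" and N0: "0 \<le> N" using M[of undefined] N[of undefined] by linarith+
  have C0: "0 < C" and C2M: "2 * M \<le> C" using M0 N0 by (simp_all add: C_def add_pos_nonneg add_nonneg_pos)
  have one: "u x - u y \<le> C * norm (x - y)" for x y
  proof (cases "x = y \<or> 2 \<le> norm (x - y)")
    case True
    then show ?thesis
    proof
      assume "2 \<le> norm (x - y)"
      then have "C * 1 \<le> C * norm (x - y)" using C0 by (intro mult_left_mono) auto
      then show ?thesis using M[of x] M[of y] C2M by linarith
    qed simp
  next
    case False
    define s where "s = norm (x - y) / 2"
    define e where "e = (1 / norm (x - y)) *\<^sub>R (x - y)"
    have ne: "norm (x - y) \<noteq> 0" using False by simp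
    then have e: "norm e = 1" by (simp add: e_def)
    have se: "s *\<^sub>R e = (1/2) *\<^sub>R (x - y)" using ne by (simp add: s_def e_def)
    have "(1/2) *\<^sub>R (x + y) + s *\<^sub>R e = (1/2) *\<^sub>R (x + x)"
      unfolding se by (simp add: scaleR_right_diff_distrib scaleR_right_distrib)
    then have x: "(1/2) *\<^sub>R (x + y) + s *\<^sub>R e = x" by (simp add: scaleR_half_double)
    have "(1/2) *\<^sub>R (x + y) - s *\<^sub>R e = (1/2) *\<^sub>R (y + y)"
      unfolding se by (simp add: scaleR_right_diff_distrib scaleR_right_distrib)
    then have y: "(1/2) *\<^sub>R (x + y) - s *\<^sub>R e = y" by (simp add: scaleR_half_double)
    have "u x - u y \<le> C * s"
      using C2_symmetric_difference_bound[OF C2 M N e, of s "(1/2) *\<^sub>R (x + y)"] False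
      unfolding x y C_def by (simp add: s_def)
    also have "\<dots> \<le> C * norm (x - y)" using C0 by (intro mult_left_mono) (auto simp: s_def)
    finally show ?thesis .
  qed
  show ?thesis
    by (rule that[OF C0]) (use one norm_minus_commute in \<open>metis abs_le_iff minus_diff_eq\<close>)
qed

section \<open>Decay at infinity\<close>

lemma has_laplacian_norm_fst_sq:
  fixes x :: "'a::euclidean_space \<times> real"
  shows "has_laplacian (\<lambda>y. (norm (fst y))\<^sup>2) x (2 * DIM('a))"
proof -
  have "has_laplacian (\<lambda>y. (norm (y - 0))\<^sup>2 - ((0, 1) \<bullet> y)\<^sup>2) x
      (2 * DIM('a \<times> real) - 2 * (norm (0 :: 'a, 1 :: real))\<^sup>2)"
    by (intro has_laplacian_diff has_laplacian_norm_sq has_laplacian_inner_sq)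
  moreover have "(norm (y - 0))\<^sup>2 - ((0, 1) \<bullet> y)\<^sup>2 = (norm (fst y))\<^sup>2" for y :: "'a \<times> real"
    by (cases y) (simp add: norm_Pair)
  ultimately show ?thesis by (simp add: norm_Pair)
qed

text \<open>A viscosity argument: \<open>W k\<close> converges to a function \<open>h\<close> of the last variable only, but no
  convergence of derivatives is available. A paraboloid concave in the first variables and convex in
  the last one moves a positive maximum of \<open>h\<close> into the interior of a cylinder, where it is stable.\<close>

lemma almost_harmonic_limit_nonpos:
  fixes W :: "nat \<Rightarrow> 'a::euclidean_space \<times> real \<Rightarrow> real"
  assumes contW: "\<And>k. continuous_on UNIV (W k)"
    and lap: "\<And>k x. has_laplacian (W k) x (g k x)"
    and conv: "\<And>r p q. strict_mono r \<Longrightarrow> p \<longlonglongrightarrow> q \<Longrightarrow> (\<lambda>j. W (r j) (p j)) \<longlonglongrightarrow> h (snd q)"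
    and gconv: "\<And>r p q. strict_mono r \<Longrightarrow> p \<longlonglongrightarrow> q \<Longrightarrow> (\<lambda>j. g (r j) (p j)) \<longlonglongrightarrow> 0"
    and conth: "continuous_on {a..b} h"
    and ends: "h a \<le> 0" "h b \<le> 0" and t0: "a \<le> t0" "t0 \<le> b"
  shows "h t0 \<le> 0"
proof (rule ccontr)
  assume "\<not> h t0 \<le> 0"
  then have ht0: "0 < h t0" by simp
  with ends t0 have t0': "a < t0" "t0 < b" by (metis less_le not_less)+
  obtain B where B: "\<And>t. t \<in> {a..b} \<Longrightarrow> h t \<le> B"
    using continuous_attains_sup[OF compact_Icc _ conth] t0 by fastforce
  \<comment> \<open>The convex term adds at most \<open>h t0 / 2\<close>, which cannot make the end
    \<open>b\<close> compete with the value at \<open>t0\<close>.\<close>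
  define \<gamma> where "\<gamma> = h t0 / (2 * (b - a)\<^sup>2)"
  have \<gamma>: "0 < \<gamma>" "\<gamma> * (b - a)\<^sup>2 = h t0 / 2" using ht0 t0' by (auto simp: \<gamma>_def)
  \<comment> \<open>Makes the Laplacian of \<open>P\<close> equal to
    \<open>2 * \<gamma> - \<gamma> = \<gamma>\<close>.\<close>
  define \<eta> where "\<eta> = \<gamma> / (2 * DIM('a))"
  have \<eta>: "0 < \<eta>" "2 * DIM('a) * \<eta> = \<gamma>" using \<gamma> by (auto simp: \<eta>_def)
  \<comment> \<open>Large enough that \<open>h + P\<close> is negative on the lateral boundary of
    the cylinder.\<close>
  define R where "R = 1 + (\<bar>B\<bar> + \<gamma> * (b - a)\<^sup>2) / \<eta>"
  have "0 \<le> (\<bar>B\<bar> + \<gamma> * (b - a)\<^sup>2) / \<eta>" using \<gamma> \<eta> by simp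
  then have R: "1 \<le> R" by (simp add: R_def)
  have "B + \<gamma> * (b - a)\<^sup>2 \<le> \<eta> * (R - 1)" using \<eta> by (simp add: R_def)
  also have "\<dots> < \<eta> * R\<^sup>2"
  proof -
    have "R * 1 \<le> R * R" using R by (intro mult_left_mono) auto
    then show ?thesis using \<eta> by (simp add: power2_eq_square)
  qed
  finally have RB: "B + \<gamma> * (b - a)\<^sup>2 < \<eta> * R\<^sup>2" .
  define P where "P = (\<lambda>x :: 'a \<times> real. \<gamma> * (snd x - a)\<^sup>2 - \<eta> * (norm (fst x))\<^sup>2)"
  have lapP: "has_laplacian P x \<gamma>" for x
  proof -
    have "has_laplacian (\<lambda>y. \<gamma> * (snd y - a)\<^sup>2 - \<eta> * (norm (fst y))\<^sup>2) x (\<gamma> * 2 - \<eta> * (2 * DIM('a)))"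
      by (intro has_laplacian_diff has_laplacian_cmult has_laplacian_norm_fst_sq
          has_laplacian_snd[where V = "\<lambda>t. (t - a)\<^sup>2" and V' = "\<lambda>t. 2 * (t - a)"])
         (auto intro!: derivative_eq_intros)
    then show ?thesis using \<eta> by (simp add: P_def mult_ac)
  qed
  have contP: "continuous_on S P" for S
    unfolding P_def by (intro continuous_intros)
  define D where "D = cball (0 :: 'a) R \<times> {a..b}"
  have D: "compact D" "(0, t0) \<in> D" using R t0 by (auto simp: D_def compact_Times)
  \<comment> \<open>Maximum points of \<open>W k + P\<close> accumulate at some \<open>q\<close>.
    The convergence hypothesis holds along moving points, so the value at \<open>q\<close> is still
    at least \<open>h t0\<close>, and this excludes all three boundary parts.\<close>
  have "\<exists>p\<in>D. \<forall>y\<in>D. W k y + P y \<le> W k p + P p" for k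
    using D by (intro continuous_attains_sup continuous_intros contP continuous_on_subset[OF contW[of k]]) auto
  then obtain p where p: "\<And>k. p k \<in> D" "\<And>k y. y \<in> D \<Longrightarrow> W k y + P y \<le> W k (p k) + P (p k)"
    by metis
  obtain q r where q: "q \<in> D" "strict_mono r" "(p \<circ> r) \<longlonglongrightarrow> q"
    using D(1) p(1) unfolding compact_def by blast
  have limP: "(\<lambda>j. P ((p \<circ> r) j)) \<longlonglongrightarrow> P q"
    by (rule continuous_on_tendsto_compose[OF contP[of UNIV] q(3)]) auto
  have "h (snd (0 :: 'a, t0)) + P (0, t0) \<le> h (snd q) + P q"
  proof (rule LIMSEQ_le)
    show "(\<lambda>j. W (r j) (0, t0) + P (0, t0)) \<longlonglongrightarrow> h (snd (0 :: 'a, t0)) + P (0, t0)"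
      by (intro tendsto_add conv q tendsto_const)
    show "(\<lambda>j. W (r j) ((p \<circ> r) j) + P ((p \<circ> r) j)) \<longlonglongrightarrow> h (snd q) + P q"
      by (intro tendsto_add conv q limP)
  qed (use p(2) D(2) in auto)
  moreover have "0 \<le> P (0, t0)" using \<gamma> by (simp add: P_def)
  ultimately have ge: "h t0 \<le> h (snd q) + P q" by simp
  have bds: "a \<le> snd q" "snd q \<le> b" "norm (fst q) \<le> R"
    using q(1) by (auto simp: D_def mem_Times_iff)
  have sq: "\<gamma> * (snd q - a)\<^sup>2 \<le> \<gamma> * (b - a)\<^sup>2"
    using bds \<gamma> by (intro mult_left_mono power_mono) auto
  have "0 \<le> \<eta> * (norm (fst q))\<^sup>2" using \<eta> by simp
  then have Ple: "P q \<le> \<gamma> * (snd q - a)\<^sup>2" by (simp add: P_def)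
  have "snd q \<noteq> a" using ge Ple ends ht0 by auto
  moreover have "snd q \<noteq> b"
  proof
    assume "snd q = b"
    then have "h t0 \<le> 0 + h t0 / 2" using ge Ple ends \<gamma> by simp
    then show False using ht0 by simp
  qed
  moreover have "norm (fst q) \<noteq> R"
  proof
    assume "norm (fst q) = R"
    then have "P q \<le> \<gamma> * (b - a)\<^sup>2 - \<eta> * R\<^sup>2" using sq by (simp add: P_def)
    then show False using ge ht0 RB B[of "snd q"] bds by simp
  qed
  ultimately have "q \<in> ball 0 R \<times> {a<..<b}"
    using bds by (auto simp: mem_Times_iff less_le)
  moreover have op: "open (ball (0 :: 'a) R \<times> {a<..<b})" by (intro open_Times) auto
  ultimately have "\<forall>\<^sub>F j in sequentially. (p \<circ> r) j \<in> ball 0 R \<times> {a<..<b}"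
    using q(3) by (blast intro: topological_tendstoD)
  \<comment> \<open>Eventually the maximum is interior, so the Laplacian of
    \<open>W (r j) + P\<close> is nonpositive there; this bounds \<open>g\<close> away from its
    limit \<open>0\<close>.\<close>
  then have "\<forall>\<^sub>F j in sequentially. g (r j) ((p \<circ> r) j) \<le> - \<gamma>"
  proof eventually_elim
    case (elim j)
    let ?k = "r j"
    have "\<forall>\<^sub>F y in nhds (p ?k). y \<in> ball 0 R \<times> {a<..<b}"
      using op elim by (simp add: eventually_nhds_in_open)
    then have "\<forall>\<^sub>F y in nhds (p ?k). - 1 * (W ?k (p ?k) + P (p ?k)) \<le> - 1 * (W ?k y + P y)"
    proof eventually_elim
      case (elim y)
      then have "y \<in> D" by (auto simp: D_def mem_Times_iff)
      then show ?case using p(2)[of y ?k] by simp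
    qed
    then have "0 \<le> - 1 * (g ?k (p ?k) + \<gamma>)"
      by (rule has_laplacian_local_min[OF has_laplacian_cmult[OF has_laplacian_add[OF lap lapP]]])
    then show ?case by simp
  qed
  then have "0 \<le> - \<gamma>"
    by (intro tendsto_upperbound[OF gconv[OF q(2,3)]]) auto
  then show False using \<gamma> by simp
qed

text \<open>Subtract the chord \<open>l\<close> of \<open>h\<close> over the interval. An affine
  function of the last variable is harmonic, so the preceding lemma applies to
  \<open>h - l\<close>.\<close>

lemma almost_harmonic_limit_convex:
  fixes W :: "nat \<Rightarrow> 'a::euclidean_space \<times> real \<Rightarrow> real"
  assumes contW: "\<And>k. continuous_on UNIV (W k)"
    and lap: "\<And>k x. has_laplacian (W k) x (g k x)"
    and conv: "\<And>r p q. strict_mono r \<Longrightarrow> p \<longlonglongrightarrow> q \<Longrightarrow> (\<lambda>j. W (r j) (p j)) \<longlonglongrightarrow> h (snd q)"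
    and gconv: "\<And>r p q. strict_mono r \<Longrightarrow> p \<longlonglongrightarrow> q \<Longrightarrow> (\<lambda>j. g (r j) (p j)) \<longlonglongrightarrow> 0"
    and conth: "continuous_on UNIV h"
    and t: "a < b" "a \<le> t" "t \<le> b"
  shows "(b - a) * h t \<le> (b - t) * h a + (t - a) * h b"
proof -
  define \<beta> where "\<beta> = (h b - h a) / (b - a)"
  define l where "l = (\<lambda>s. h a + \<beta> * (s - a))"
  have "\<beta> * (b - a) = h b - h a" using t by (simp add: \<beta>_def)
  then have lb: "l b = h b" by (simp add: l_def)
  have "h t - l t \<le> 0"
  proof (rule almost_harmonic_limit_nonpos[where W = "\<lambda>k x. W k x - l (snd x)" and g = "\<lambda>k x. g k x - 0"
        and h = "\<lambda>s. h s - l s" and a = a and b = b])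
    show "continuous_on UNIV (\<lambda>x. W k x - l (snd x))" for k
      unfolding l_def by (intro continuous_intros contW)
    show "has_laplacian (\<lambda>x. W k x - l (snd x)) x (g k x - 0)" for k x
      unfolding l_def
      by (intro has_laplacian_diff lap has_laplacian_snd[where V' = "\<lambda>t. \<beta>"])
         (auto intro!: derivative_eq_intros)
    show "(\<lambda>j. W (r j) (p j) - l (snd (p j))) \<longlonglongrightarrow> h (snd q) - l (snd q)"
      if "strict_mono r" "p \<longlonglongrightarrow> q" for r p q
      unfolding l_def by (intro tendsto_intros conv that)
    show "(\<lambda>j. g (r j) (p j) - 0) \<longlonglongrightarrow> 0" if "strict_mono r" "p \<longlonglongrightarrow> q" for r p q
      using gconv[OF that] by simp
    show "continuous_on {a..b} (\<lambda>s. h s - l s)"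
      unfolding l_def by (intro continuous_intros continuous_on_subset[OF conth]) auto
  qed (use t lb in \<open>auto simp: l_def\<close>)
  then have "(b - a) * h t \<le> (b - a) * l t" using t by (intro mult_left_mono) auto
  also have "\<dots> = (b - t) * h a + (t - a) * h b"
    using \<open>\<beta> * (b - a) = h b - h a\<close> unfolding l_def by algebra
  finally show ?thesis .
qed

section \<open>Auxiliary facts for the limit of translates\<close>

lemma C1_real_lipschitz_on_interval:
  fixes f :: "real \<Rightarrow> real"
  assumes "f C1_differentiable_on UNIV"
  obtains L where "0 \<le> L" "\<And>x y. \<lbrakk>a \<le> x; x \<le> b; a \<le> y; y \<le> b\<rbrakk> \<Longrightarrow> \<bar>f x - f y\<bar> \<le> L * \<bar>x - y\<bar>"
proof -
  obtain D where D: "\<And>x. (f has_real_derivative D x) (at x)" "continuous_on UNIV D"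
    using assms by (auto simp: C1_differentiable_on_def has_real_derivative_iff_has_vector_derivative)
  have "bounded (D ` {a..b})"
    by (intro compact_imp_bounded compact_continuous_image continuous_on_subset[OF D(2)]) auto
  then obtain L where L: "\<And>x. x \<in> {a..b} \<Longrightarrow> norm (D x) \<le> L"
    unfolding bounded_iff by blast
  show ?thesis
  proof (rule that[of "max 0 L"])
    fix x y
    assume xy: "a \<le> x" "x \<le> b" "a \<le> y" "y \<le> b"
    have "norm (f x - f y) \<le> max 0 L * norm (x - y)"
      by (rule field_differentiable_bound[of "{a..b}" f D])
         (use D(1) L xy in \<open>auto intro: has_field_derivative_at_within simp: max.coboundedI2\<close>)
    then show "\<bar>f x - f y\<bar> \<le> max 0 L * \<bar>x - y\<bar>" by simp
  qed simp
qed

lemma C1_differentiable_imp_continuous: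
  fixes f :: "real \<Rightarrow> real"
  assumes "f C1_differentiable_on UNIV"
  shows "continuous_on UNIV f"
  using assms C1_differentiable_imp_continuous_on by blast

lemma antiderivative_real:
  fixes f :: "real \<Rightarrow> real"
  assumes "continuous_on UNIV f"
  obtains F where "\<And>x. (F has_real_derivative f x) (at x)"
proof -
  have "isCont f x" for x using assms by (simp add: continuous_on_eq_continuous_at)
  then have "\<exists>F. \<forall>x::real. -\<infinity> < ereal x \<longrightarrow> ereal x < \<infinity> \<longrightarrow> (F has_vector_derivative f x) (at x)"
    by (intro einterval_antiderivative) auto
  then show ?thesis using that by (auto simp: has_real_derivative_iff_has_vector_derivative)
qed

text \<open>Mean value inequality on the ball about \<open>a\<close> of radius
  \<open>norm y\<close>, which stays where the gradient bound holds. Only the slice at height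
  \<open>t\<close> enters, since the decay of the gradient is not uniform in
  \<open>t\<close>.\<close>

lemma grad_fst_bound_imp_small_difference:
  fixes u :: "'a::euclidean_space \<times> real \<Rightarrow> real"
  assumes diff: "\<And>x. u differentiable at x"
    and small: "\<And>y. norm y \<ge> B \<Longrightarrow> norm (grad_fst u (y, t)) \<le> e"
    and a: "norm a \<ge> B + norm y"
  shows "\<bar>u (a + y, t) - u (a, t)\<bar> \<le> e * norm y"
proof -
  have d: "(\<lambda>y. u (y, t)) differentiable at x" for x
  proof -
    have "(\<lambda>y :: 'a. (y, t)) differentiable at x"
      unfolding differentiable_def by (auto intro!: exI derivative_eq_intros)
    then show ?thesis
      using differentiable_chain_at[of "\<lambda>y. (y, t)" x u] diff by (simp add: o_def)
  qed
  have "norm (u (a + y, t) - u (a, t)) \<le> e * norm (a + y - a)"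
  proof (rule differentiable_bound[of "cball a (norm y)" "\<lambda>y. u (y, t)" "\<lambda>x h. h \<bullet> grad (\<lambda>y. u (y, t)) x"])
    fix x assume x: "x \<in> cball a (norm y)"
    show "((\<lambda>y. u (y, t)) has_derivative (\<lambda>h. h \<bullet> grad (\<lambda>y. u (y, t)) x)) (at x within cball a (norm y))"
      using GDERIV_grad[OF d] unfolding gderiv_def by (rule has_derivative_at_withinI)
    have "B \<le> norm x"
      using x a norm_triangle_ineq2[of a x] by (simp add: dist_norm)
    then have "norm (grad (\<lambda>y. u (y, t)) x) \<le> e"
      using small[of x] by (simp add: grad_fst_def)
    then have "norm (h \<bullet> grad (\<lambda>y. u (y, t)) x) \<le> e * norm h" for h
      using order_trans[OF Cauchy_Schwarz_ineq2 mult_left_mono[OF _ norm_ge_zero]]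
      by (simp add: mult.commute)
    then show "onorm (\<lambda>h. h \<bullet> grad (\<lambda>y. u (y, t)) x) \<le> e"
      by (rule onorm_le)
  qed (auto simp: dist_norm)
  then show ?thesis by simp
qed

text \<open>The compactness part of Arzela-Ascoli: a diagonal subsequence converges at all
  rationals, and the common Lipschitz constant carries the Cauchy property to every
  \<open>t\<close>.\<close>

lemma lipschitz_pointwise_compactness:
  fixes w :: "nat \<Rightarrow> real \<Rightarrow> real"
  assumes M: "\<And>n t. \<bar>w n t\<bar> \<le> M" and C: "0 < C" "\<And>n s t. \<bar>w n s - w n t\<bar> \<le> C * \<bar>s - t\<bar>"
  obtains r v where "strict_mono (r :: nat \<Rightarrow> nat)" "\<And>t. (\<lambda>n. w (r n) t) \<longlonglongrightarrow> v t"
proof -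
  obtain r where r: "strict_mono (r :: nat \<Rightarrow> nat)" "\<And>t. t \<in> \<rat> \<Longrightarrow> \<exists>l. (\<lambda>n. w (r n) t) \<longlonglongrightarrow> l"
    using function_convergent_subsequence[of \<rat> w M] M countable_rat by auto
  have "Cauchy (\<lambda>n. w (r n) t)" for t
  proof (rule metric_CauchyI)
    fix e :: real
    assume e: "0 < e"
    have "0 < e / (4 * C)" using e C by simp
    then obtain q where q: "q \<in> \<rat>" "t < q" "q < t + e / (4 * C)"
      using Rats_dense_in_real[of t "t + e / (4 * C)"] by auto
    have Cq: "C * \<bar>t - q\<bar> < e / 4"
      using q C by (simp add: field_simps)
    have "Cauchy (\<lambda>n. w (r n) q)" using r(2)[OF q(1)] LIMSEQ_imp_Cauchy by blast
    then obtain K where K: "\<And>m n. m \<ge> K \<Longrightarrow> n \<ge> K \<Longrightarrow> dist (w (r m) q) (w (r n) q) < e / 2"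
      using e unfolding Cauchy_def by (meson half_gt_zero)
    show "\<exists>K. \<forall>m\<ge>K. \<forall>n\<ge>K. dist (w (r m) t) (w (r n) t) < e"
    proof (intro exI allI impI)
      fix m n assume "m \<ge> K" "n \<ge> K"
      then have "\<bar>w (r m) q - w (r n) q\<bar> < e / 2" using K by (simp add: dist_real_def)
      moreover have "\<bar>w (r m) t - w (r m) q\<bar> < e / 4" "\<bar>w (r n) t - w (r n) q\<bar> < e / 4"
        using C(2)[of "r m" t q] C(2)[of "r n" t q] Cq by linarith+
      ultimately show "dist (w (r m) t) (w (r n) t) < e"
        unfolding dist_real_def by linarith
    qed
  qed
  then have "\<forall>t. \<exists>l. (\<lambda>n. w (r n) t) \<longlonglongrightarrow> l"
    by (auto simp: Cauchy_convergent_iff convergent_def)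
  then show ?thesis using that[OF r(1)] by metis
qed

text \<open>Since \<open>f 0 = 0\<close> and \<open>f\<close> is Lipschitz on the range of
  \<open>v\<close>, the equation gives \<open>v'' \<le> L * v\<close>. By the strong maximum
  principle a single zero would make \<open>v\<close> vanish identically.\<close>

lemma nonneg_solves_1d_pos:
  assumes f_C1: "f C1_differentiable_on UNIV" and f_0: "f 0 = 0"
    and v: "\<And>t. (v has_real_derivative v' t) (at t)" "\<And>t. (v' has_real_derivative - f (v t)) (at t)"
    and bd: "\<And>t. 0 \<le> v t" "\<And>t. v t \<le> M" and pos: "0 < v s"
  shows "0 < v t"
proof (rule ccontr)
  assume "\<not> 0 < v t"
  then have vt: "v t = 0" using bd(1)[of t] by simp
  obtain L where L: "0 \<le> L" "\<And>x y. \<lbrakk>0 \<le> x; x \<le> M; 0 \<le> y; y \<le> M\<rbrakk> \<Longrightarrow> \<bar>f x - f y\<bar> \<le> L * \<bar>x - y\<bar>"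
    using C1_real_lipschitz_on_interval[OF f_C1] by metis
  have M: "0 \<le> M" using bd order_trans by blast
  have "v s = 0"
  proof (rule strong_maximum_principle[of UNIV t v 0 s])
    show "v differentiable at x" for x
      using v(1) real_differentiable_def by blast
    have "- f (v y) \<le> L * v y" for y
      using L(2)[of 0 "v y"] bd M f_0 by (auto simp: abs_le_iff)
    then have "\<forall>\<^sub>F y in nhds x. \<exists>K. has_laplacian v y K \<and> K \<le> L * (v y - 0)" for x
      using has_laplacian_real[OF v] by (auto intro!: always_eventually)
    then show "\<exists>L\<ge>0. \<forall>\<^sub>F y in nhds x. \<exists>K. has_laplacian v y K \<and> K \<le> L * (v y - 0)" for x
      using L(1) by blast
  qed (use vt bd in auto)
  then show False using pos by simp
qed

text \<open>The points \<open>0\<close>, \<open>1\<close>, \<open>t\<close> are put in increasing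
  order, and the identity is used for the middle one.\<close>

lemma affine_of_convex_combination:
  fixes h :: "real \<Rightarrow> real"
  assumes "\<And>a b t. a < b \<Longrightarrow> a \<le> t \<Longrightarrow> t \<le> b \<Longrightarrow> (b - a) * h t = (b - t) * h a + (t - a) * h b"
  shows "h t = h 0 + t * (h 1 - h 0)"
proof -
  consider "t < 0" | "0 \<le> t" "t \<le> 1" | "1 < t" by linarith
  then show ?thesis
  proof cases
    case 1
    have "(1 - t) * h 0 = 1 * h t + (0 - t) * h 1" using assms[of t 1 0] 1 by simp
    then show ?thesis by (simp add: algebra_simps)
  next
    case 2
    then show ?thesis using assms[of 0 1 t] by (simp add: algebra_simps)
  next
    case 3
    have "t * h 1 = (t - 1) * h 0 + h t" using assms[of 0 t 1] 3 by simp
    then show ?thesis by (simp add: algebra_simps)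
  qed
qed

lemma tendsto_zero_at_infinity:
  fixes u :: "'a::euclidean_space \<times> real \<Rightarrow> real"
  assumes f_C1: "f C1_differentiable_on UNIV"
    and f_0: "f 0 = 0"
    and no_1d: "\<not> (\<exists>v. solves_1d f v \<and> (\<forall>t. v t > 0))"
    and u_C2: "C2 u"
    and u_pos: "\<And>x. u x > 0"
    and u_bounded: "\<And>x. u x \<le> M"
    and u_eq: "\<And>x. - laplacian u x = f (u x)"
    and u_lim: "uniform_limit UNIV (\<lambda>t x'. u (x', t)) (\<lambda>x'. 0) at_infinity"
    and u_grad_lim: "\<And>t. ((\<lambda>x'. grad_fst u (x', t)) \<longlongrightarrow> 0) at_infinity"
  shows "(u \<longlongrightarrow> 0) at_infinity"
proof (rule ccontr)
  assume "\<not> (u \<longlongrightarrow> 0) at_infinity"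
  then obtain \<delta> where \<delta>0: "0 < \<delta>" "\<not> (\<exists>R. \<forall>x. R \<le> norm x \<longrightarrow> dist (u x) 0 < \<delta>)"
    unfolding tendsto_iff eventually_at_infinity by blast
  have dist_u: "dist (u x) 0 = u x" for x using u_pos[of x] by (simp add: dist_real_def)
  have \<delta>: "0 < \<delta>" "\<And>R. \<exists>x. R \<le> norm x \<and> \<delta> \<le> u x"
    using \<delta>0 unfolding dist_u by (auto simp: not_less)
  have contf: "continuous_on UNIV f" by (rule C1_differentiable_imp_continuous[OF f_C1])
  have contu: "continuous_on S u" for S using u_C2 by (rule C2_continuous)
  have diffu: "u differentiable at x" for x using u_C2 unfolding C2_def C1_def by blast
  have M0: "0 < M" using u_pos u_bounded less_le_trans by blast
  have "bounded (f ` {0..M})"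
    by (intro compact_imp_bounded compact_continuous_image continuous_on_subset[OF contf]) auto
  then obtain N where N: "\<And>s. s \<in> {0..M} \<Longrightarrow> \<bar>f s\<bar> \<le> N"
    unfolding bounded_iff real_norm_def by blast
  have "\<bar>laplacian u x\<bar> \<le> N" for x
  proof -
    have "laplacian u x = - f (u x)" using u_eq[of x] by simp
    then show ?thesis using N[of "u x"] u_pos[of x] u_bounded[of x] by simp
  qed
  moreover have "\<bar>u x\<bar> \<le> M" for x using u_pos[of x] u_bounded[of x] by simp
  ultimately obtain C where C: "0 < C" "\<And>x y. \<bar>u x - u y\<bar> \<le> C * norm (x - y)"
    using C2_bounded_laplacian_lipschitz[OF u_C2] by metis
  have Ct: "\<bar>u (y, s) - u (y, t)\<bar> \<le> C * \<bar>s - t\<bar>" for y s t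
    using C(2)[of "(y, s)" "(y, t)"] by (simp add: norm_Pair)
  have unif: "\<exists>T. \<forall>t. T \<le> \<bar>t\<bar> \<longrightarrow> (\<forall>y. u (y, t) < e)" if "0 < e" for e
    using uniform_limitD[OF u_lim that]
    unfolding eventually_at_infinity dist_commute[of "u _"] real_norm_def
    by (simp add: dist_commute[of 0] abs_of_pos[OF u_pos])
  obtain T where T: "\<And>t y. T \<le> \<bar>t\<bar> \<Longrightarrow> u (y, t) < \<delta>" using unif[OF \<delta>(1)] by blast
  \<comment> \<open>Uniform decay in the last variable confines the heights of these points to
    \<open>{-T..T}\<close>, so only their first components escape.\<close>
  have "\<forall>k :: nat. \<exists>x. real k \<le> norm x \<and> \<delta> \<le> u x" using \<delta>(2) by blast
  then obtain X where X: "\<And>k :: nat. real k \<le> norm (X k)" "\<And>k. \<delta> \<le> u (X k)"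
    by metis
  have sndX: "snd (X k) \<in> {-T..T}" for k
  proof -
    have "\<not> T \<le> \<bar>snd (X k)\<bar>"
      using T[of "snd (X k)" "fst (X k)"] X(2)[of k] by auto
    then show ?thesis by auto
  qed
  then obtain ts r0 where r0: "strict_mono r0" "((\<lambda>k. snd (X k)) \<circ> r0) \<longlonglongrightarrow> ts"
    using compact_Icc[of "-T" T] unfolding compact_def by metis
  define A0 where "A0 = (\<lambda>k. fst (X (r0 k)))"
  have A0: "real k - T \<le> norm (A0 k)" for k
  proof -
    have "real k \<le> real (r0 k)" using seq_suble[OF r0(1)] by simp
    also have "\<dots> \<le> norm (X (r0 k))" by (rule X)
    also have "\<dots> \<le> norm (A0 k) + norm (snd (X (r0 k)))"
      unfolding A0_def by (metis norm_Pair_le prod.collapse)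
    also have "norm (snd (X (r0 k))) \<le> T" using sndX[of "r0 k"] by (simp add: abs_le_iff)
    finally show ?thesis by simp
  qed
  obtain r1 v where r1: "strict_mono (r1 :: nat \<Rightarrow> nat)" "\<And>t. (\<lambda>n. u (A0 (r1 n), t)) \<longlonglongrightarrow> v t"
    using lipschitz_pointwise_compactness[of "\<lambda>n t. u (A0 n, t)" M C] \<open>\<And>x. \<bar>u x\<bar> \<le> M\<close> C(1) Ct by metis
  define A where "A = (\<lambda>n. A0 (r1 n))"
  have A_lim: "(\<lambda>n. u (A n, t)) \<longlonglongrightarrow> v t" for t using r1(2) by (simp add: A_def)
  \<comment> \<open>A quantitative escape to infinity, which passes to every further
    subsequence.\<close>
  have A_ge: "real n - T \<le> norm (A n)" for n
    using A0[of "r1 n"] seq_suble[OF r1(1), of n] unfolding A_def by linarith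
  have v_nonneg: "0 \<le> v t" for t
    by (rule LIMSEQ_le_const[OF A_lim]) (use u_pos less_imp_le in blast)
  have v_le: "v t \<le> M" for t
    by (rule LIMSEQ_le_const2[OF A_lim]) (use u_bounded in blast)
  have v_lip: "\<bar>v s - v t\<bar> \<le> C * \<bar>s - t\<bar>" for s t
    by (rule LIMSEQ_le_const2[OF tendsto_rabs[OF tendsto_diff[OF A_lim A_lim]]]) (use Ct in blast)
  have contv: "continuous_on UNIV v"
    by (rule lipschitz_on_continuous_on[of C], rule lipschitz_onI)
       (use v_lip C in \<open>auto simp: dist_real_def\<close>)
  have v_tendsto: "(v \<longlongrightarrow> 0) at_infinity"
    unfolding tendsto_iff
  proof (intro allI impI)
    fix e :: real assume e: "0 < e"
    then obtain T' where T': "\<And>t y. T' \<le> \<bar>t\<bar> \<Longrightarrow> u (y, t) < e / 2" using unif[of "e / 2"] by auto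
    have "v t \<le> e / 2" if "T' \<le> \<bar>t\<bar>" for t
      by (rule LIMSEQ_le_const2[OF A_lim]) (use T' that less_imp_le in blast)
    then show "\<forall>\<^sub>F t in at_infinity. dist (v t) 0 < e"
      unfolding eventually_at_infinity using v_nonneg e by (intro exI[of _ T']) fastforce
  qed
  \<comment> \<open>Convergence along moving points, as the viscosity lemmas require.\<close>
  have conv: "(\<lambda>j. u (p j + (A (r j), 0))) \<longlonglongrightarrow> v (snd q)"
    if r: "strict_mono r" and p: "p \<longlonglongrightarrow> q" for r :: "nat \<Rightarrow> nat" and p q
  proof -
    let ?t = "snd q"
    obtain K where K: "\<And>j. norm (p j) \<le> K"
      using p convergent_imp_bounded[of p q] by (auto simp: bounded_iff)
    have K0: "0 \<le> K" using K norm_ge_zero order_trans by blast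
    have fst_le: "norm (fst (p j)) \<le> K" for j
      using K[of j] norm_fst_le[of "fst (p j)" "snd (p j)"] by simp
    \<comment> \<open>The gradient decays only for each fixed height. The displacement in the first
      variables is therefore made at the limit height \<open>?t\<close>, and the change of height is
      left to the Lipschitz bound.\<close>
    have 0: "(\<lambda>j. u (A (r j) + fst (p j), ?t) - u (A (r j), ?t)) \<longlonglongrightarrow> 0"
    proof (rule LIMSEQ_I)
      fix e :: real assume e: "0 < e"
      define e' where "e' = e / (2 * (K + 1))"
      have e': "0 < e'" using e K0 by (simp add: e'_def)
      obtain B where B: "\<And>y. B \<le> norm y \<Longrightarrow> norm (grad_fst u (y, ?t)) < e'"
        using tendstoD[OF u_grad_lim e', of ?t] by (auto simp: eventually_at_infinity)
      obtain n0 where n0: "B + K + T \<le> real n0" using real_arch_simple by blast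
      show "\<exists>no. \<forall>n\<ge>no. norm (u (A (r n) + fst (p n), ?t) - u (A (r n), ?t) - 0) < e"
      proof (intro exI[of _ n0] allI impI)
        fix n assume "n \<ge> n0"
        then have "B + K \<le> real (r n) - T" using seq_suble[OF r, of n] n0 by linarith
        also have "\<dots> \<le> norm (A (r n))" by (rule A_ge)
        finally have "\<bar>u (A (r n) + fst (p n), ?t) - u (A (r n), ?t)\<bar> \<le> e' * norm (fst (p n))"
          using B fst_le[of n] by (intro grad_fst_bound_imp_small_difference[where B = B] diffu) (auto intro: less_imp_le)
        also have "\<dots> \<le> e' * (K + 1)" using e' fst_le[of n] by (intro mult_left_mono) auto
        also have "\<dots> = e / 2" using K0 by (simp add: e'_def field_simps)
        also have "\<dots> < e" using e by simp
        finally show "norm (u (A (r n) + fst (p n), ?t) - u (A (r n), ?t) - 0) < e" by simp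
      qed
    qed
    have "(\<lambda>j. u (A (r j), ?t)) \<longlonglongrightarrow> v ?t"
      using LIMSEQ_subseq_LIMSEQ[OF A_lim r] by (simp add: o_def)
    from tendsto_add[OF 0 this] have 1: "(\<lambda>j. u (A (r j) + fst (p j), ?t)) \<longlonglongrightarrow> v ?t"
      by simp
    have "(\<lambda>j. C * \<bar>snd (p j) - ?t\<bar>) \<longlonglongrightarrow> C * \<bar>?t - ?t\<bar>"
      by (intro tendsto_intros p)
    then have lim0: "(\<lambda>j. C * \<bar>snd (p j) - ?t\<bar>) \<longlonglongrightarrow> 0" by simp
    have "(\<lambda>j. u (A (r j) + fst (p j), snd (p j)) - u (A (r j) + fst (p j), ?t)) \<longlonglongrightarrow> 0"
      by (rule Lim_null_comparison[OF always_eventually lim0]) (simp add: Ct)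
    from tendsto_add[OF this 1] have "(\<lambda>j. u (A (r j) + fst (p j), snd (p j))) \<longlonglongrightarrow> v ?t"
      by simp
    moreover have "p j + (A (r j), 0) = (A (r j) + fst (p j), snd (p j))" for j
      by (cases "p j") (simp add: add.commute)
    ultimately show ?thesis by simp
  qed
  \<comment> \<open>The chosen points are the translates of \<open>(0, ?s n)\<close>, so the lower
    bound \<open>\<delta>\<close> passes to the limit and \<open>v\<close> is nontrivial.\<close>
  have "\<delta> \<le> v ts"
  proof -
    let ?s = "\<lambda>n. snd (X (r0 (r1 n)))"
    have s: "?s \<longlonglongrightarrow> ts"
      using LIMSEQ_subseq_LIMSEQ[OF r0(2) r1(1)] by (simp add: o_def)
    then have "(\<lambda>n. (0 :: 'a, ?s n)) \<longlonglongrightarrow> (0, ts)" by (intro tendsto_intros)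
    from conv[OF strict_mono_id this] have "(\<lambda>n. u (X (r0 (r1 n)))) \<longlonglongrightarrow> v ts"
      by (simp add: A_def A0_def)
    then show ?thesis by (rule LIMSEQ_le_const) (use X(2) in blast)
  qed
  then have v_pos: "0 < v ts" using \<delta> by simp
  have contfv: "continuous_on UNIV (\<lambda>t. - f (v t))"
    by (intro continuous_intros continuous_on_compose2[OF contf contv]) auto
  \<comment> \<open>The second antiderivative \<open>G\<close> of \<open>- f \<circ> v\<close> is
    what \<open>v\<close> should equal up to an affine term. The functions \<open>W k\<close>
    converge to \<open>h = v - G\<close> and their Laplacians tend to \<open>0\<close>, without any
    derivative of \<open>v\<close> being known.\<close>
  obtain F where F: "\<And>t. (F has_real_derivative - f (v t)) (at t)"
    using antiderivative_real[OF contfv] by blast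
  have "continuous_on UNIV F" using F by (meson DERIV_isCont continuous_at_imp_continuous_on)
  then obtain G where G: "\<And>t. (G has_real_derivative F t) (at t)"
    using antiderivative_real by blast
  have contG: "continuous_on UNIV G" using G by (meson DERIV_isCont continuous_at_imp_continuous_on)
  define h where "h = (\<lambda>t. v t - G t)"
  define W where "W = (\<lambda>k x. u (x + (A k, 0)) - G (snd x))"
  define g where "g = (\<lambda>k x. - f (u (x + (A k, 0))) - - f (v (snd x)))"
  have contW: "continuous_on UNIV (W k)" for k
    unfolding W_def
    by (intro continuous_intros continuous_on_compose2[OF contu[of UNIV]] continuous_on_compose2[OF contG]) auto
  have lapW: "has_laplacian (W k) x (g k x)" for k x
  proof -
    have "laplacian u y = - f (u y)" for y using u_eq[of y] by simp
    then have "has_laplacian (\<lambda>y. u (y + (A k, 0))) x (- f (u (x + (A k, 0))))"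
      using has_laplacian_translate[OF C2_has_laplacian[OF u_C2]] by metis
    then show ?thesis
      unfolding W_def g_def by (intro has_laplacian_diff has_laplacian_snd[OF G F])
  qed
  have limcomp: "(\<lambda>j. \<phi> (y j)) \<longlonglongrightarrow> \<phi> l" if "continuous_on UNIV \<phi>" "y \<longlonglongrightarrow> l"
    for \<phi> :: "real \<Rightarrow> real" and y l
    by (rule continuous_on_tendsto_compose[OF that]) auto
  have convW: "(\<lambda>j. W (r j) (p j)) \<longlonglongrightarrow> h (snd q)" if "strict_mono r" "p \<longlonglongrightarrow> q" for r p q
    unfolding W_def h_def by (intro tendsto_diff conv limcomp[OF contG] tendsto_snd that)
  have convg: "(\<lambda>j. g (r j) (p j)) \<longlonglongrightarrow> 0" if "strict_mono r" "p \<longlonglongrightarrow> q" for r p q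
  proof -
    have "(\<lambda>j. g (r j) (p j)) \<longlonglongrightarrow> - f (v (snd q)) - - f (v (snd q))"
      unfolding g_def
      by (intro tendsto_diff tendsto_minus limcomp[OF contf] limcomp[OF contv] conv tendsto_snd that)
    then show ?thesis by simp
  qed
  have conth: "continuous_on UNIV h" unfolding h_def by (intro continuous_intros contv contG)
  \<comment> \<open>Convexity of the limit is applied to \<open>W\<close> and to its negative, so
    \<open>h\<close> is both convex and concave.\<close>
  have "(b - a) * h t = (b - t) * h a + (t - a) * h b" if t: "a < b" "a \<le> t" "t \<le> b" for a b t
  proof (rule antisym)
    show "(b - a) * h t \<le> (b - t) * h a + (t - a) * h b"
      by (rule almost_harmonic_limit_convex[OF contW lapW convW convg conth t])
    have "(b - a) * (- 1 * h t) \<le> (b - t) * (- 1 * h a) + (t - a) * (- 1 * h b)"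
    proof (rule almost_harmonic_limit_convex[where W = "\<lambda>k x. - 1 * W k x" and g = "\<lambda>k x. - 1 * g k x"
          and h = "\<lambda>t. - 1 * h t", OF _ has_laplacian_cmult[OF lapW] _ _ _ t])
      show "(\<lambda>j. - 1 * g (r j) (p j)) \<longlonglongrightarrow> 0" if "strict_mono r" "p \<longlonglongrightarrow> q" for r p q
        using tendsto_minus[OF convg[OF that]] by simp
    qed (intro continuous_intros contW conth tendsto_intros convW; assumption)+
    then show "(b - t) * h a + (t - a) * h b \<le> (b - a) * h t" by simp
  qed
  then have h_aff: "h t = h 0 + t * (h 1 - h 0)" for t by (rule affine_of_convex_combination)
  define v' where "v' = (\<lambda>t. F t + (h 1 - h 0))"
  \<comment> \<open>Regularity of \<open>v\<close> is read off here: it is \<open>G\<close> plus an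
    affine function.\<close>
  have "v = (\<lambda>t. G t + (h 0 + t * (h 1 - h 0)))"
    unfolding h_aff[symmetric] by (simp add: h_def)
  then have dv: "(v has_real_derivative v' t) (at t)" for t
    unfolding v'_def by (auto intro!: derivative_eq_intros G)
  have dv': "(v' has_real_derivative - f (v t)) (at t)" for t
    unfolding v'_def by (auto intro!: derivative_eq_intros F)
  have deriv: "deriv v = v'" "deriv v' = (\<lambda>t. - f (v t))"
    using DERIV_imp_deriv[OF dv] DERIV_imp_deriv[OF dv'] by auto
  have "continuous_on UNIV v'" using dv' by (meson DERIV_isCont continuous_at_imp_continuous_on)
  then have "v C1_differentiable_on UNIV"
    using dv by (auto simp: C1_differentiable_on_def has_real_derivative_iff_has_vector_derivative)
  moreover have "v' C1_differentiable_on UNIV"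
    unfolding C1_differentiable_on_def has_real_derivative_iff_has_vector_derivative[symmetric]
    using dv' contfv by (intro exI[of _ "\<lambda>t. - f (v t)"]) simp
  ultimately have "solves_1d f v"
    unfolding solves_1d_def deriv using v_nonneg v_tendsto by simp
  moreover have "\<forall>t. 0 < v t"
    using nonneg_solves_1d_pos[OF f_C1 f_0 dv dv' v_nonneg v_le v_pos] by blast
  ultimately show False using no_1d by blast
qed

section \<open>Moving planes\<close>

lemma inner_reflect: "norm e = 1 \<Longrightarrow> e \<bullet> reflect e l x = 2 * l - e \<bullet> x"
  by (simp add: reflect_def inner_simps norm_eq_1)

lemma reflect_line:
  assumes "norm e = 1" "e \<bullet> p = l"
  shows "reflect e l (p + t *\<^sub>R e) = p + (- t) *\<^sub>R e"
proof -
  have "reflect e l (p + t *\<^sub>R e) = p + (t + 2 * (l - (l + t))) *\<^sub>R e"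
    using assms unfolding scaleR_add_left by (simp add: reflect_def inner_simps norm_eq_1 add.assoc)
  then show ?thesis by simp
qed

lemma reflect_involution: "norm e = 1 \<Longrightarrow> reflect e l (reflect e l x) = x"
  unfolding reflect_def[of e l "reflect e l x"] by (simp add: inner_reflect) (simp add: reflect_def algebra_simps flip: scaleR_add_left)

text \<open>The setting once decay in all directions is known. No coordinate is distinguished any
  more, so the space is an arbitrary Euclidean one.\<close>

locale decaying_solution =
  fixes f :: "real \<Rightarrow> real" and \<epsilon> :: real and u :: "'a::euclidean_space \<Rightarrow> real"
  assumes f_C1: "f C1_differentiable_on UNIV"
    and \<epsilon>_pos: "\<epsilon> > 0"
    and f_deriv: "\<And>s. 0 < s \<Longrightarrow> s < \<epsilon> \<Longrightarrow> deriv f s \<le> 0"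
    and u_C2: "C2 u"
    and u_pos: "\<And>x. u x > 0"
    and u_bounded: "bounded (range u)"
    and u_eq: "\<And>x. - laplacian u x = f (u x)"
    and u_lim: "(u \<longlongrightarrow> 0) at_infinity"
begin

lemma small_outside_ball:
  assumes "0 < c"
  obtains R where "0 < R" "\<And>x. R \<le> norm x \<Longrightarrow> u x < c"
proof -
  obtain R where R: "\<And>x. R \<le> norm x \<Longrightarrow> u x < c"
    using order_tendstoD(2)[OF u_lim assms] by (auto simp: eventually_at_infinity)
  show ?thesis by (rule that[of "max R 1"]) (auto intro: R)
qed

lemma f_antimono:
  assumes "0 < a" "a \<le> b" "b < \<epsilon>"
  shows "f b \<le> f a"
proof (rule DERIV_nonpos_imp_nonincreasing[OF assms(2)])
  fix x assume x: "a \<le> x" "x \<le> b"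
  obtain D where "(f has_real_derivative D) (at x)"
    using f_C1 by (auto simp: C1_differentiable_on_def has_real_derivative_iff_has_vector_derivative)
  then show "\<exists>y. (f has_real_derivative y) (at x) \<and> y \<le> 0"
    using f_deriv[of x] x assms DERIV_imp_deriv by (intro exI[of _ D]) fastforce
qed

definition reflect_diff :: "'a \<Rightarrow> real \<Rightarrow> 'a \<Rightarrow> real" where
  "reflect_diff e l x = u (reflect e l x) - u x"

lemma continuous_u: "continuous_on S u"
  using u_C2 by (rule C2_continuous)

lemma differentiable_u: "u differentiable at x"
  using u_C2 unfolding C2_def C1_def by blast

lemma continuous_reflect_diff: "continuous_on S (reflect_diff e l)"
  unfolding reflect_diff_def[abs_def] reflect_def
  by (intro continuous_intros continuous_u continuous_on_compose2[OF continuous_u[of UNIV]]) auto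

lemma differentiable_reflect_diff: "reflect_diff e l differentiable at x"
proof -
  have "reflect e l differentiable at x"
    unfolding reflect_def[abs_def] differentiable_def by (auto intro!: exI derivative_eq_intros)
  then have "(\<lambda>x. u (reflect e l x)) differentiable at x"
    using differentiable_chain_at[of "reflect e l" x u] differentiable_u by (simp add: o_def)
  then show ?thesis
    unfolding reflect_diff_def[abs_def] using differentiable_u by (rule differentiable_diff)
qed

lemma has_laplacian_reflect_diff:
  assumes "norm e = 1"
  shows "has_laplacian (reflect_diff e l) x (f (u x) - f (u (reflect e l x)))"
proof -
  have "has_laplacian (reflect_diff e l) x (laplacian u (reflect e l x) - laplacian u x)"
    unfolding reflect_diff_def[abs_def]
    by (intro has_laplacian_diff has_laplacian_reflect C2_has_laplacian u_C2 assms)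
  moreover have "laplacian u (reflect e l x) - laplacian u x = f (u x) - f (u (reflect e l x))"
    using u_eq[of x] u_eq[of "reflect e l x"] by simp
  ultimately show ?thesis by simp
qed

lemma reflect_diff_boundary: "e \<bullet> x = l \<Longrightarrow> reflect_diff e l x = 0"
  by (simp add: reflect_diff_def reflect_fixed)

lemma reflect_diff_gt: "- u x < reflect_diff e l x"
  using u_pos[of "reflect e l x"] by (simp add: reflect_diff_def)

text \<open>Suppose \<open>u < \<epsilon>\<close> wherever the difference is negative. Monotonicity
  of \<open>f\<close> makes the difference superharmonic there, so the strong maximum principle
  spreads its negative minimum over the half-space. This is incompatible with the lower bound
  \<open>- u\<close>, which tends to \<open>0\<close>.\<close>

lemma reflect_diff_negative_in_core:
  assumes e: "norm e = 1" and x1: "l < e \<bullet> x1" "reflect_diff e l x1 < 0"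
  shows "\<exists>x. l < e \<bullet> x \<and> reflect_diff e l x < 0 \<and> \<epsilon> \<le> u x"
proof (rule ccontr)
  assume no: "\<not> ?thesis"
  let ?w = "reflect_diff e l"
  \<comment> \<open>Outside the ball of radius \<open>R\<close> the difference exceeds
    \<open>- c\<close>, so its minimum over the half-space is attained in the compact set
    \<open>D\<close>.\<close>
  define c where "c = - ?w x1"
  have c: "0 < c" using x1 by (simp add: c_def)
  obtain R where R: "0 < R" "\<And>x. R \<le> norm x \<Longrightarrow> u x < c"
    using small_outside_ball[OF c] by blast
  have far: "- c < ?w x" if "R \<le> norm x" for x
    using reflect_diff_gt[of x e l] R(2)[OF that] by linarith
  define D where "D = cball (0 :: 'a) R \<inter> {x. l \<le> e \<bullet> x}"
  have "compact D"
    unfolding D_def by (intro compact_Int_closed compact_cball closed_Collect_le continuous_intros)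
  moreover have x1D: "x1 \<in> D"
    using far[of x1] x1 by (cases "R \<le> norm x1") (auto simp: D_def c_def)
  ultimately obtain p where p: "p \<in> D" "\<And>y. y \<in> D \<Longrightarrow> ?w p \<le> ?w y"
    using continuous_attains_inf[of D ?w] continuous_reflect_diff by blast
  define S where "S = {x. l < e \<bullet> x}"
  have wp: "?w p \<le> - c" using p(2)[OF x1D] by (simp add: c_def)
  have "e \<bullet> p \<noteq> l" using wp c reflect_diff_boundary[of e p l] by auto
  then have pS: "p \<in> S" using p(1) by (auto simp: D_def S_def)
  have ge: "?w p \<le> ?w x" if "x \<in> S" for x
    using far[of x] wp p(2)[of x] that by (cases "R \<le> norm x") (auto simp: D_def S_def)
  have S: "open S" "connected S"
    unfolding S_def
    by (auto intro!: open_Collect_less continuous_intros convex_connected convex_halfspace_gt)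
  \<comment> \<open>A point of the half-space far enough out for \<open>far\<close> to contradict
    the spread minimum.\<close>
  define y where "y = p + (norm p + R) *\<^sub>R e"
  have "y \<in> S"
  proof -
    have "e \<bullet> y = e \<bullet> p + (norm p + R)" using e by (simp add: y_def inner_simps norm_eq_1)
    then show ?thesis using pS R(1) norm_ge_zero[of p] unfolding S_def mem_Collect_eq by linarith
  qed
  have "?w y = ?w p"
  proof (rule strong_maximum_principle[OF S pS refl differentiable_reflect_diff ge _ \<open>y \<in> S\<close>])
    fix x assume x: "x \<in> S" "?w x = ?w p"
    \<comment> \<open>The comparison of \<open>f\<close>-values needs \<open>?w\<close> negative,
      which continuity provides near a minimum point.\<close>
    have "isCont ?w x" using continuous_reflect_diff[of UNIV] by (simp add: continuous_on_eq_continuous_at)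
    then have "\<forall>\<^sub>F y in nhds x. ?w y < 0"
      using x wp c unfolding isCont_def tendsto_at_iff_tendsto_nhds
      by (auto dest: order_tendstoD(2)[of _ _ _ 0])
    moreover have "\<forall>\<^sub>F y in nhds x. y \<in> S" using S x by (simp add: eventually_nhds_in_open)
    ultimately have "\<forall>\<^sub>F y in nhds x. \<exists>K. has_laplacian ?w y K \<and> K \<le> 0 * (?w y - ?w p)"
    proof eventually_elim
      case (elim y)
      then have "u y < \<epsilon>" using no by (auto simp: S_def)
      moreover have "u (reflect e l y) \<le> u y" using elim by (simp add: reflect_diff_def)
      ultimately have "f (u y) \<le> f (u (reflect e l y))" using f_antimono u_pos by blast
      then show ?case using has_laplacian_reflect_diff[OF e, of l y] by fastforce
    qed
    then show "\<exists>L\<ge>0. \<forall>\<^sub>F y in nhds x. \<exists>K. has_laplacian ?w y K \<and> K \<le> L * (?w y - ?w p)"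
      by blast
  qed
  moreover have "R \<le> norm y"
    using norm_triangle_ineq2[of "(norm p + R) *\<^sub>R e" "- p"] e R by (simp add: y_def add.commute)
  ultimately show False using far[of y] wp by simp
qed

definition directional_deriv :: "'a \<Rightarrow> 'a \<Rightarrow> real" where
  "directional_deriv e x = (\<Sum>i\<in>Basis. (e \<bullet> i) * partial_deriv i u x)"

lemma directional_deriv:
  "((\<lambda>t. u (x + t *\<^sub>R e)) has_real_derivative directional_deriv e (x + t *\<^sub>R e)) (at t)"
  unfolding directional_deriv_def using u_C2 by (intro C1_line_derivative) (simp add: C2_def)

lemma continuous_directional_deriv: "continuous_on UNIV (directional_deriv e)"
  unfolding directional_deriv_def[abs_def]
  using u_C2 by (intro continuous_intros) (auto simp: C2_def C1_def)

text \<open>Hopf's lemma on the unit ball about \<open>p + e\<close>, which touches the hyperplane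
  at \<open>p\<close>. Reflection reverses \<open>e\<close>, so the derivative of the difference
  along \<open>e\<close> at \<open>p\<close> is \<open>-2\<close> times that of
  \<open>u\<close>.\<close>

lemma hopf_directional_deriv:
  assumes e: "norm e = 1" and pos: "\<And>x. l < e \<bullet> x \<Longrightarrow> 0 < reflect_diff e l x" and p: "e \<bullet> p = l"
  shows "directional_deriv e p < 0"
proof -
  let ?w = "reflect_diff e l"
  obtain M where M: "\<And>x. \<bar>u x\<bar> \<le> M" using u_bounded by (auto simp: bounded_iff)
  obtain L where L: "0 \<le> L" "\<And>x y. \<lbrakk>- M \<le> x; x \<le> M; - M \<le> y; y \<le> M\<rbrakk> \<Longrightarrow> \<bar>f x - f y\<bar> \<le> L * \<bar>x - y\<bar>"
    using C1_real_lipschitz_on_interval[OF f_C1] by metis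
  have Lu: "\<bar>f (u x) - f (u y)\<bar> \<le> L * \<bar>u x - u y\<bar>" for x y
    using L(2)[of "u x" "u y"] M[of x] M[of y] by (simp add: abs_le_iff)
  obtain w' where w': "(?w has_derivative w') (at p)"
    using differentiable_reflect_diff unfolding differentiable_def by blast
  have inner_bd: "\<bar>e \<bullet> x - (l + 1)\<bar> \<le> norm (x - (p + e))" for x
    using Cauchy_Schwarz_ineq2[of e "x - (p + e)"] e p by (simp add: inner_simps norm_eq_1)
  have in_ball: "l < e \<bullet> x" if "x \<in> ball (p + e) 1" for x
    using inner_bd[of x] that by (simp add: dist_norm norm_minus_commute)
  have w'_pos: "0 < w' (p + e - p)"
  proof (rule hopf_lemma[OF zero_less_one L(1) continuous_reflect_diff _ _ _ _ w'])
    fix x assume "x \<in> ball (p + e) 1"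
    then have "0 < ?w x" using in_ball pos by blast
    then show "0 < ?w x" "\<exists>K. has_laplacian ?w x K \<and> K \<le> L * ?w x"
      using has_laplacian_reflect_diff[OF e, of l x] Lu[of x "reflect e l x"]
      by (auto simp: reflect_diff_def abs_if split: if_splits)
  next
    fix x assume "x \<in> cball (p + e) 1"
    then have "l \<le> e \<bullet> x" using inner_bd[of x] by (simp add: dist_norm norm_minus_commute abs_le_iff)
    then show "0 \<le> ?w x" using pos[of x] reflect_diff_boundary[of e x l] by (cases "e \<bullet> x = l") auto
  qed (use e p reflect_diff_boundary in auto)
  have d1: "((\<lambda>t. ?w (p + t *\<^sub>R e)) has_real_derivative w' e) (at 0)"
  proof -
    have "((\<lambda>t. ?w (p + t *\<^sub>R e)) has_derivative (\<lambda>t. w' (t *\<^sub>R e))) (at 0)"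
      by (rule has_derivative_compose[where g = ?w and g' = w'])
         (use w' in \<open>auto intro!: derivative_eq_intros\<close>)
    moreover have "(\<lambda>t. w' (t *\<^sub>R e)) = (*) (w' e)"
      using has_derivative_linear[OF w'] by (auto simp: linear_cmul fun_eq_iff)
    ultimately show ?thesis by (simp add: has_field_derivative_def)
  qed
  have d2: "((\<lambda>t. ?w (p + t *\<^sub>R e)) has_real_derivative - 2 * directional_deriv e p) (at 0)"
  proof -
    have "?w (p + t *\<^sub>R e) = u (p + (- t) *\<^sub>R e) - u (p + t *\<^sub>R e)" for t
      using reflect_line[OF e p] by (simp add: reflect_diff_def)
    moreover have "((\<lambda>t. u (p + (- t) *\<^sub>R e)) has_real_derivative directional_deriv e (p + (- 0) *\<^sub>R e) * (- 1)) (at 0)"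
      by (rule DERIV_chain2[where f = "\<lambda>t. u (p + t *\<^sub>R e)" and g = uminus, OF directional_deriv])
         (auto intro!: derivative_eq_intros)
    ultimately show ?thesis
      using DERIV_diff[OF _ directional_deriv[of p e 0]] by fastforce
  qed
  show ?thesis using w'_pos DERIV_unique[OF d1 d2] by simp
qed

section \<open>Admissible positions of the moving plane\<close>

definition nonneg_beyond :: "'a \<Rightarrow> real \<Rightarrow> bool" where
  "nonneg_beyond e l \<longleftrightarrow> (\<forall>x. l < e \<bullet> x \<longrightarrow> 0 \<le> reflect_diff e l x)"

text \<open>Start of the procedure: a violation would force a point with
  \<open>u \<ge> \<epsilon>\<close> beyond the plane, hence outside the ball of radius
  \<open>R\<close>.\<close>

lemma nonneg_beyond_large:
  assumes e: "norm e = 1" and R: "\<And>x. R \<le> norm x \<Longrightarrow> u x < \<epsilon>" and "R \<le> l"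
  shows "nonneg_beyond e l"
proof (rule ccontr)
  assume "\<not> nonneg_beyond e l"
  then obtain x where x: "l < e \<bullet> x" "\<epsilon> \<le> u x"
    using reflect_diff_negative_in_core[OF e] by (force simp: nonneg_beyond_def not_le)
  have "e \<bullet> x \<le> norm x" using norm_cauchy_schwarz[of e x] e by simp
  then show False using R[of x] x assms(3) by linarith
qed

text \<open>The plane must stop: past \<open>- R\<close> the origin is reflected to a point where
  \<open>u\<close> is smaller than \<open>u 0\<close>.\<close>

lemma nonneg_beyond_bounded_below:
  assumes e: "norm e = 1" and R: "0 < R" "\<And>x. R \<le> norm x \<Longrightarrow> u x < u 0" and l: "nonneg_beyond e l"
  shows "- R \<le> l"
proof (rule ccontr)
  assume lR: "\<not> - R \<le> l"
  then have "0 \<le> reflect_diff e l 0" using l R by (simp add: nonneg_beyond_def)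
  then have "u 0 \<le> u ((2 * l) *\<^sub>R e)" by (simp add: reflect_diff_def reflect_def)
  moreover have "R \<le> norm ((2 * l) *\<^sub>R e)" using lR R e by simp
  ultimately show False using R(2)[of "(2 * l) *\<^sub>R e"] by linarith
qed

text \<open>The difference \<open>w\<close> is nonnegative and satisfies
  \<open>\<Delta> w \<le> L * w\<close> beyond the plane, so one zero spreads to the whole
  half-space. The other side follows by reflecting back.\<close>

lemma symmetric_of_zero:
  assumes e: "norm e = 1" and l: "nonneg_beyond e l" and p: "l < e \<bullet> p" "reflect_diff e l p = 0"
  shows "u (reflect e l x) = u x"
proof -
  let ?w = "reflect_diff e l"
  define S where "S = {x. l < e \<bullet> x}"
  obtain M where M: "\<And>x. \<bar>u x\<bar> \<le> M" using u_bounded by (auto simp: bounded_iff)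
  obtain L where L: "0 \<le> L" "\<And>x y. \<lbrakk>- M \<le> x; x \<le> M; - M \<le> y; y \<le> M\<rbrakk> \<Longrightarrow> \<bar>f x - f y\<bar> \<le> L * \<bar>x - y\<bar>"
    using C1_real_lipschitz_on_interval[OF f_C1] by metis
  have Lu: "\<bar>f (u x) - f (u y)\<bar> \<le> L * \<bar>u x - u y\<bar>" for x y
    using L(2)[of "u x" "u y"] M[of x] M[of y] by (simp add: abs_le_iff)
  have S: "open S" "connected S" "p \<in> S"
    unfolding S_def using p
    by (auto intro!: open_Collect_less continuous_intros convex_connected convex_halfspace_gt)
  have zero: "?w y = 0" if "y \<in> S" for y
  proof (rule strong_maximum_principle[OF S p(2) differentiable_reflect_diff _ _ that])
    show "0 \<le> ?w x" if "x \<in> S" for x using l that by (simp add: nonneg_beyond_def S_def)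
    fix x assume "x \<in> S"
    then have "\<forall>\<^sub>F y in nhds x. y \<in> S" using S by (simp add: eventually_nhds_in_open)
    then have "\<forall>\<^sub>F y in nhds x. \<exists>K. has_laplacian ?w y K \<and> K \<le> L * (?w y - 0)"
    proof eventually_elim
      case (elim y)
      then have "0 \<le> ?w y" using l by (simp add: nonneg_beyond_def S_def)
      then show ?case
        using has_laplacian_reflect_diff[OF e, of l y] Lu[of y "reflect e l y"]
        by (auto simp: reflect_diff_def abs_if split: if_splits)
    qed
    then show "\<exists>L\<ge>0. \<forall>\<^sub>F y in nhds x. \<exists>K. has_laplacian ?w y K \<and> K \<le> L * (?w y - 0)"
      using L(1) by blast
  qed
  consider "l < e \<bullet> x" | "e \<bullet> x = l" | "l < e \<bullet> reflect e l x"
    using inner_reflect[OF e, of l x] by linarith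
  then show ?thesis
  proof cases
    case 1
    then show ?thesis using zero[of x] by (simp add: S_def reflect_diff_def)
  next
    case 2
    then show ?thesis by (simp add: reflect_fixed)
  next
    case 3
    then show ?thesis
      using zero[of "reflect e l x"] by (simp add: S_def reflect_diff_def reflect_involution[OF e])
  qed
qed

lemma continuous_u_tendsto: "X \<longlonglongrightarrow> x \<Longrightarrow> (\<lambda>n. u (X n)) \<longlonglongrightarrow> u x"
  by (rule continuous_on_tendsto_compose[OF continuous_u[of UNIV]]) auto

lemma reflect_diff_tendsto:
  assumes "X \<longlonglongrightarrow> x" "\<mu> \<longlonglongrightarrow> l"
  shows "(\<lambda>n. reflect_diff e (\<mu> n) (X n)) \<longlonglongrightarrow> reflect_diff e l x"
  unfolding reflect_diff_def
  by (intro tendsto_diff continuous_u_tendsto assms) (unfold reflect_def, intro tendsto_intros assms)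

text \<open>Mean value theorem on the segment from the mirror image of \<open>x\<close> to
  \<open>x\<close>, whose length is \<open>2 * (e \<bullet> x - m)\<close>.\<close>

lemma directional_deriv_positive_between:
  assumes "norm e = 1" "m < e \<bullet> x" "reflect_diff e m x < 0"
  obtains s where "0 \<le> s" "s \<le> 2 * (e \<bullet> x - m)" "0 < directional_deriv e (x - s *\<^sub>R e)"
proof -
  define \<tau> where "\<tau> = 2 * (e \<bullet> x - m)"
  have \<tau>: "0 < \<tau>" using assms by (simp add: \<tau>_def)
  have "reflect e m x = x + (- \<tau>) *\<^sub>R e"
    unfolding reflect_def \<tau>_def by (rule arg_cong[where f = "\<lambda>c. x + c *\<^sub>R e"]) simp
  then have lt: "u (x + (- \<tau>) *\<^sub>R e) < u (x + 0 *\<^sub>R e)" using assms by (simp add: reflect_diff_def)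
  obtain z where z: "- \<tau> < z" "z < 0"
      "u (x + 0 *\<^sub>R e) - u (x + (- \<tau>) *\<^sub>R e) = (0 - (- \<tau>)) * directional_deriv e (x + z *\<^sub>R e)"
    using MVT2[of "- \<tau>" 0 "\<lambda>t. u (x + t *\<^sub>R e)" "\<lambda>t. directional_deriv e (x + t *\<^sub>R e)"]
      directional_deriv \<tau> by auto
  have "0 < \<tau> * directional_deriv e (x + z *\<^sub>R e)" using z(3) lt by simp
  then have "0 < directional_deriv e (x - (- z) *\<^sub>R e)" using \<tau> by (simp add: zero_less_mult_iff)
  then show ?thesis using that[of "- z"] z by (simp add: \<tau>_def)
qed

lemma exists_symmetry_hyperplane:
  assumes e: "norm e = 1"
  shows "\<exists>l. \<forall>x. u (reflect e l x) = u x"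
proof -
  obtain R where R: "0 < R" "\<And>x. R \<le> norm x \<Longrightarrow> u x < \<epsilon>"
    using small_outside_ball[OF \<epsilon>_pos] by blast
  obtain R0 where R0: "0 < R0" "\<And>x. R0 \<le> norm x \<Longrightarrow> u x < u 0"
    using small_outside_ball[OF u_pos] by blast
  \<comment> \<open>Asking for all positions above \<open>l\<close> makes \<open>A\<close> upward
    closed, so every position above its infimum is admissible.\<close>
  define A where "A = {l. \<forall>\<mu>\<ge>l. nonneg_beyond e \<mu>}"
  have A_ne: "A \<noteq> {}"
    using nonneg_beyond_large[OF e R(2), of R] nonneg_beyond_large[OF e R(2)] by (auto simp: A_def)
  have A_bdd: "bdd_below A"
    using nonneg_beyond_bounded_below[OF e R0] by (intro bdd_belowI[of _ "- R0"]) (auto simp: A_def)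
  define l where "l = Inf A"
  have above: "nonneg_beyond e \<mu>" if "l < \<mu>" for \<mu>
    using that A_ne A_bdd unfolding l_def by (auto simp: cInf_less_iff A_def)
  have seq_down: "(\<lambda>n. l + 1 / (real n + 1)) \<longlonglongrightarrow> l"
    using tendsto_add[OF tendsto_const[of l] LIMSEQ_inverse_real_of_nat] by (simp add: inverse_eq_divide add.commute)
  have at_l: "nonneg_beyond e l"
    unfolding nonneg_beyond_def
  proof (intro allI impI)
    fix x assume x: "l < e \<bullet> x"
    have "\<forall>\<^sub>F n in sequentially. l + 1 / (real n + 1) < e \<bullet> x"
      using order_tendstoD(2)[OF seq_down x] .
    then have "\<forall>\<^sub>F n in sequentially. 0 \<le> reflect_diff e (l + 1 / (real n + 1)) x"
    proof eventually_elim
      case (elim n)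
      have "nonneg_beyond e (l + 1 / (real n + 1))" by (rule above) simp
      then show ?case using elim by (simp add: nonneg_beyond_def)
    qed
    then show "0 \<le> reflect_diff e l x"
      by (intro tendsto_lowerbound[OF reflect_diff_tendsto[OF tendsto_const seq_down]]) auto
  qed
  \<comment> \<open>Otherwise the difference is strictly positive beyond the critical plane, and
    Hopf's lemma fixes the sign of the derivative on it. Inadmissible positions just below the plane
    will contradict that sign.\<close>
  have "\<exists>p. l < e \<bullet> p \<and> reflect_diff e l p = 0"
  proof (rule ccontr)
    assume "\<not> ?thesis"
    then have pos: "0 < reflect_diff e l x" if "l < e \<bullet> x" for x
      using at_l that by (force simp: nonneg_beyond_def less_le)
    have "\<exists>\<mu> x. l - 1 / (real n + 1) \<le> \<mu> \<and> \<mu> \<le> l \<and> \<mu> < e \<bullet> x \<and> reflect_diff e \<mu> x < 0 \<and> \<epsilon> \<le> u x" for n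
    proof -
      have "l - 1 / (real n + 1) < l" by simp
      then have "l - 1 / (real n + 1) \<notin> A"
        unfolding l_def using cInf_lower[OF _ A_bdd] by (meson leD)
      then obtain \<mu> where \<mu>: "l - 1 / (real n + 1) \<le> \<mu>" "\<not> nonneg_beyond e \<mu>" by (auto simp: A_def)
      then obtain x where "\<mu> < e \<bullet> x" "reflect_diff e \<mu> x < 0" "\<epsilon> \<le> u x"
        using reflect_diff_negative_in_core[OF e] by (force simp: nonneg_beyond_def not_le)
      moreover have "\<mu> \<le> l" using above \<mu>(2) not_le by blast
      ultimately show ?thesis using \<mu>(1) by blast
    qed
    then obtain \<mu> X where X: "\<And>n :: nat. l - 1 / (real n + 1) \<le> \<mu> n" "\<And>n. \<mu> n \<le> l"
        "\<And>n. \<mu> n < e \<bullet> X n" "\<And>n. reflect_diff e (\<mu> n) (X n) < 0" "\<And>n. \<epsilon> \<le> u (X n)"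
      by metis
    have lo: "(\<lambda>n. l - 1 / (real n + 1)) \<longlonglongrightarrow> l"
      using tendsto_diff[OF tendsto_const[of l] LIMSEQ_inverse_real_of_nat] by (simp add: inverse_eq_divide add.commute)
    have \<mu>_lim: "\<mu> \<longlonglongrightarrow> l"
      by (rule tendsto_sandwich[OF _ _ lo tendsto_const]) (use X in auto)
    have "X n \<in> cball 0 R" for n
    proof -
      have "\<not> R \<le> norm (X n)" using R(2)[of "X n"] X(5)[of n] by linarith
      then show ?thesis by simp
    qed
    then obtain p r where r: "strict_mono r" "(X \<circ> r) \<longlonglongrightarrow> p"
      using compact_cball[of 0 R] unfolding compact_def by metis
    have \<mu>r: "(\<lambda>n. \<mu> (r n)) \<longlonglongrightarrow> l"
      using LIMSEQ_subseq_LIMSEQ[OF \<mu>_lim r(1)] by (simp add: o_def)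
    have Xr: "(\<lambda>n. X (r n)) \<longlonglongrightarrow> p" using r(2) by (simp add: o_def)
    \<comment> \<open>The violating points lie in a fixed ball. Their limit cannot be beyond the
      plane, by strict positivity, nor below it, so it lies on the plane.\<close>
    have "reflect_diff e l p \<le> 0"
      by (rule LIMSEQ_le_const2[OF reflect_diff_tendsto[OF Xr \<mu>r]]) (use X(4) less_imp_le in blast)
    then have "\<not> l < e \<bullet> p" using pos by force
    moreover have "l \<le> e \<bullet> p"
      by (rule LIMSEQ_le[OF \<mu>r tendsto_inner[OF tendsto_const Xr]]) (use X(3) less_imp_le in blast)
    ultimately have p: "e \<bullet> p = l" by simp
    \<comment> \<open>The shifts \<open>s n\<close> vanish in the limit because
      \<open>e \<bullet> X n\<close> and \<open>\<mu> n\<close> have the same limit along the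
      subsequence, so the derivative of \<open>u\<close> along \<open>e\<close> at \<open>p\<close>
      is nonnegative.\<close>
    have "\<exists>s. 0 \<le> s \<and> s \<le> 2 * (e \<bullet> X n - \<mu> n) \<and> 0 < directional_deriv e (X n - s *\<^sub>R e)" for n
      using directional_deriv_positive_between[OF e X(3,4)[of n]] by blast
    then obtain s where s: "\<And>n. 0 \<le> s n" "\<And>n. s n \<le> 2 * (e \<bullet> X n - \<mu> n)"
        "\<And>n. 0 < directional_deriv e (X n - s n *\<^sub>R e)"
      by metis
    have "(\<lambda>n. 2 * (e \<bullet> X (r n) - \<mu> (r n))) \<longlonglongrightarrow> 2 * (e \<bullet> p - l)"
      by (intro tendsto_intros Xr \<mu>r)
    then have hi: "(\<lambda>n. 2 * (e \<bullet> X (r n) - \<mu> (r n))) \<longlonglongrightarrow> 0" using p by simp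
    have "(\<lambda>n. s (r n)) \<longlonglongrightarrow> 0"
      by (rule tendsto_sandwich[OF _ _ tendsto_const hi]) (use s in auto)
    then have "(\<lambda>n. X (r n) - s (r n) *\<^sub>R e) \<longlonglongrightarrow> p - 0 *\<^sub>R e"
      by (intro tendsto_intros Xr)
    then have "(\<lambda>n. directional_deriv e (X (r n) - s (r n) *\<^sub>R e)) \<longlonglongrightarrow> directional_deriv e (p - 0 *\<^sub>R e)"
      by (rule continuous_on_tendsto_compose[OF continuous_directional_deriv]) auto
    then have "0 \<le> directional_deriv e (p - 0 *\<^sub>R e)"
      by (rule LIMSEQ_le_const) (use s(3) less_imp_le in blast)
    then show False using hopf_directional_deriv[OF e pos p] by simp
  qed
  then show ?thesis using symmetric_of_zero[OF e at_l] by blast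
qed

section \<open>From hyperplanes of symmetry to radial symmetry\<close>

lemma radially_symmetric: "\<exists>y g. \<forall>x. u x = g (norm (x - y))"
proof -
  have "\<forall>b\<in>Basis. \<exists>l. \<forall>x. u (reflect b l x) = u x"
    using exists_symmetry_hyperplane by simp
  then obtain c where c: "\<And>b x. b \<in> Basis \<Longrightarrow> u (reflect b (c b) x) = u x"
    by metis
  define y where "y = (\<Sum>b\<in>Basis. c b *\<^sub>R b)"
  \<comment> \<open>Composition of the reflections in the coordinate directions of \<open>B\<close>.
    By orthogonality the earlier reflections leave \<open>a \<bullet> x\<close> unchanged, so the
    displacements add up.\<close>
  have partial: "u (x + (\<Sum>b\<in>B. (2 * (c b - b \<bullet> x)) *\<^sub>R b)) = u x" if "finite B" "B \<subseteq> Basis" for B x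
    using that
  proof (induction B)
    case (insert a B)
    let ?z = "x + (\<Sum>b\<in>B. (2 * (c b - b \<bullet> x)) *\<^sub>R b)"
    have "a \<bullet> b = 0" if "b \<in> B" for b
      using insert that by (metis inner_not_same_Basis insert_subset subsetD)
    then have "a \<bullet> ?z = a \<bullet> x" by (simp add: inner_add_right inner_sum_right)
    then have "x + (\<Sum>b\<in>insert a B. (2 * (c b - b \<bullet> x)) *\<^sub>R b) = reflect a (c a) ?z"
      using insert by (simp add: reflect_def algebra_simps)
    then show ?case using insert c by simp
  qed simp
  have central: "u (2 *\<^sub>R y - x) = u x" for x
  proof -
    have "(\<Sum>b\<in>Basis. (2 * (c b - b \<bullet> x)) *\<^sub>R b) = 2 *\<^sub>R y - 2 *\<^sub>R (\<Sum>b\<in>Basis. (x \<bullet> b) *\<^sub>R b)"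
      by (simp add: y_def scaleR_sum_right sum_subtractf[symmetric] algebra_simps inner_commute)
    then have "x + (\<Sum>b\<in>Basis. (2 * (c b - b \<bullet> x)) *\<^sub>R b) = 2 *\<^sub>R y - x"
      by (simp add: euclidean_representation scaleR_2)
    then show ?thesis using partial[of Basis x] by simp
  qed
  have through_center: "u (reflect e (e \<bullet> y) x) = u x" if e: "norm e = 1" for e x
  proof -
    obtain l where l: "\<And>x. u (reflect e l x) = u x"
      using exists_symmetry_hyperplane[OF e] by blast
    have "l = e \<bullet> y"
    proof (rule ccontr)
      assume ne: "l \<noteq> e \<bullet> y"
      \<comment> \<open>This composition preserves \<open>u\<close> and shifts
        \<open>e \<bullet> x\<close> by the fixed nonzero amount
        \<open>2 * (l - e \<bullet> y)\<close>. Its orbit through \<open>0\<close> is unbounded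
        while \<open>u\<close> keeps the value \<open>u 0\<close>.\<close>
      define T where "T = (\<lambda>x. reflect e l (2 *\<^sub>R y - x))"
      have uT: "u (T x) = u x" for x by (simp add: T_def l central)
      have eT: "e \<bullet> T x = e \<bullet> x + 2 * (l - e \<bullet> y)" for x
        by (simp add: T_def inner_reflect[OF e] inner_simps)
      have iter: "u ((T ^^ n) 0) = u 0 \<and> e \<bullet> (T ^^ n) 0 = n * (2 * (l - e \<bullet> y))" for n
        by (induction n) (auto simp: uT eT algebra_simps)
      obtain R where R: "0 < R" "\<And>x. R \<le> norm x \<Longrightarrow> u x < u 0"
        using small_outside_ball[OF u_pos] by blast
      obtain n :: nat where n: "R / \<bar>2 * (l - e \<bullet> y)\<bar> \<le> n" using real_arch_simple by blast
      have "R \<le> \<bar>n * (2 * (l - e \<bullet> y))\<bar>"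
        using n ne by (simp add: abs_mult divide_le_eq)
      also have "\<dots> \<le> norm ((T ^^ n) 0)"
        using Cauchy_Schwarz_ineq2[of e "(T ^^ n) 0"] e iter[of n] by simp
      finally show False using R(2) iter[of n] by fastforce
    qed
    then show ?thesis using l by simp
  qed
  \<comment> \<open>Two distinct points equidistant from \<open>y\<close> are mirror images in their
    bisecting hyperplane, which passes through \<open>y\<close>.\<close>
  have eq: "u x = u x'" if eqn: "norm (x - y) = norm (x' - y)" for x x'
  proof (cases "x = x'")
    case False
    define d where "d = norm (x - x')"
    define e where "e = (1 / d) *\<^sub>R (x - x')"
    have d: "d \<noteq> 0" using False by (simp add: d_def)
    then have e: "norm e = 1" by (simp add: e_def d_def)
    have "(x - y) \<bullet> (x - y) = (x' - y) \<bullet> (x' - y)"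
      using eqn by (simp add: norm_eq)
    then have "2 * ((x - x') \<bullet> (y - x)) = - ((x - x') \<bullet> (x - x'))"
      by (simp add: inner_simps inner_commute algebra_simps)
    also have "\<dots> = - (d * d)" by (simp add: d_def dot_square_norm power2_eq_square)
    finally have "2 * ((x - x') \<bullet> (y - x)) = - (d * d)" .
    moreover have "e \<bullet> y - e \<bullet> x = (1 / d) * ((x - x') \<bullet> (y - x))"
      unfolding e_def inner_diff_right[symmetric] by (simp only: inner_scaleR_left)
    ultimately have "2 * (e \<bullet> y - e \<bullet> x) = (1 / d) * - (d * d)"
      by (metis mult.left_commute)
    then have "2 * (e \<bullet> y - e \<bullet> x) = - d" using d by simp
    then have "reflect e (e \<bullet> y) x = x + (- d) *\<^sub>R e" by (simp add: reflect_def)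
    also have "\<dots> = x'" using d by (simp add: e_def)
    finally show ?thesis using through_center[OF e, of x] by simp
  qed simp
  \<comment> \<open>The profile is read off along the ray from \<open>y\<close> in the direction
    \<open>b\<close>.\<close>
  obtain b :: 'a where b: "b \<in> Basis" by (meson nonempty_Basis ex_in_conv)
  have "u x = u (y + norm (x - y) *\<^sub>R b)" for x
    by (rule eq) (use b in simp)
  then show ?thesis by (intro exI[of _ y] exI[of _ "\<lambda>r. u (y + r *\<^sub>R b)"]) blast
qed

end

text \<open>The finite, hence nonempty, index type \<open>'m\<close> supplies the first
  \<open>N - 1\<close> variables, so \<open>N\<close> is at least 2. Radial symmetry is expressed by
  a profile \<open>g\<close> of the distance to the centre.\<close>

theorem theorem3:
  fixes f :: "real \<Rightarrow> real"
    and \<epsilon> :: real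
    and u :: "(real ^ 'm) \<times> real \<Rightarrow> real"
  assumes f_C1: "f C1_differentiable_on UNIV"
    and f_0: "f 0 = 0"
    and \<epsilon>_pos: "\<epsilon> > 0"
    and f_deriv: "\<forall>s\<in>{0<..<\<epsilon>}. deriv f s \<le> 0"
    and no_1d: "\<not> (\<exists>v. solves_1d f v \<and> (\<forall>t. v t > 0))"
    and u_C2: "C2 u"
    and u_pos: "\<forall>x. u x > 0"
    and u_bounded: "bounded (range u)"
    and u_eq: "\<forall>x. - laplacian u x = f (u x)"
    and u_lim: "uniform_limit UNIV (\<lambda>t x'. u (x', t)) (\<lambda>x'. 0) at_infinity"
    and u_grad_lim: "\<forall>t. ((\<lambda>x'. grad_fst u (x', t)) \<longlongrightarrow> 0) at_infinity"
  shows "\<exists>y g. \<forall>x. u x = g (norm (x - y))"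
proof -
  obtain M where M: "\<And>x. u x \<le> M"
    using u_bounded by (auto simp: bounded_iff abs_le_iff)
  have "(u \<longlongrightarrow> 0) at_infinity"
    by (rule tendsto_zero_at_infinity[OF f_C1 f_0 no_1d u_C2 _ M _ u_lim])
       (use u_pos u_eq u_grad_lim in blast)+
  then interpret decaying_solution f \<epsilon> u
    using assms by unfold_locales auto
  show ?thesis by (rule radially_symmetric)
qed

end
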